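(* For monic real-rooted polynomials $p(x) = \prod_{i=1}^n (x - \alpha_i)$ and $q(x) = \prod_{i=1}^n (x - \beta_i)$ of degree $n$, let $\alpha = (\alpha_1, \dots, \alpha_n)^\top$, $\beta = (\beta_1, \dots, \beta_n)^\top \in \mathbb{R}^n$. Then $$\big((p \boxplus_n q)(x)\big)^2 - (p^2 \boxplus_{2n} q^2)(x) \quad\text{and}\quad \big((p \boxtimes_n q)(x)\big)^2 - (p^2 \boxtimes_{2n} q^2)(x)$$ are sum-of-squares polynomials in $x$, $\alpha$ and $\beta$; that is, viewed as polynomials in the $2n+1$ variables $x,\alpha_1,\dots,\alpha_n,\beta_1,\dots,\beta_n$, each is a finite sum of squares of polynomials with real coefficients in these variables.
   Context: For polynomials $p(x) = \sum_{i=0}^n x^{n-i}(-1)^i a_i$ and $q(x) = \sum_{i=0}^n x^{n-i}(-1)^i b_i$ of degree at most $n$, the finite free additive and multiplicative convolutions are $$(p \boxplus_n q)(x) = \sum_{k=0}^n x^{n-k}(-1)^k \sum_{\substack{0\le i,j\le k\\ i+j=k}} \frac{(n-i)!(n-j)!}{n!(n-k)!} a_i b_j,\qquad (p \boxtimes_n q)(x) = \sum_{i=0}^n x^{n-i}(-1)^i \frac{a_i b_i}{\binom{n}{i}}.$$ $p^2,q^2$ are ordinary squares of polynomials. The coefficients of $p, q, p^2, q^2$ in $x$ are polynomials in the roots $\alpha_i,\beta_i$, so the expressions in the claim are polynomials in $x,\alpha,\beta$. *)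

theory Defs
  imports "HOL-Analysis.Analysis" "HOL-Computational_Algebra.Polynomial"
begin

text \<open>
  For \<open>degree p \<le> n\<close>, \<open>signed_coeff n p i\<close> is the \<open>a i\<close> in
  \<open>p(x) = (\<Sum>i\<le>n. x^(n-i) * (-1)^i * a i)\<close>. It depends on \<open>n\<close>, which need not be the degree
  of \<open>p\<close>, and is meant for \<open>i \<le> n\<close> only.
\<close>

definition signed_coeff :: "nat \<Rightarrow> real poly \<Rightarrow> nat \<Rightarrow> real" where
  "signed_coeff n p i = (-1) ^ i * coeff p (n - i)"

definition finite_free_add :: "nat \<Rightarrow> real poly \<Rightarrow> real poly \<Rightarrow> real poly" where
  "finite_free_add n p q =
     (\<Sum>k\<le>n. monom ((-1) ^ k *
        (\<Sum>(i, j)\<in>{(i, j). i + j = k}.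
           fact (n - i) * fact (n - j) / (fact n * fact (n - k))
             * signed_coeff n p i * signed_coeff n q j)) (n - k))"

definition finite_free_mult :: "nat \<Rightarrow> real poly \<Rightarrow> real poly \<Rightarrow> real poly" where
  "finite_free_mult n p q =
     (\<Sum>i\<le>n. monom ((-1) ^ i *
        (signed_coeff n p i * signed_coeff n q i / real (n choose i))) (n - i))"

definition poly_of_roots :: "real ^ 'n \<Rightarrow> real poly" where
  "poly_of_roots \<alpha> = (\<Prod>i\<in>UNIV. [:- (\<alpha> $ i), 1:])"

text \<open>
  Multivariate polynomials with real coefficients are represented by the functions they induce
  on a Euclidean space; this loses nothing, since the field of real numbers is infinite.
\<close>

definition sum_of_squares_polynomial :: "('a::euclidean_space \<Rightarrow> real) \<Rightarrow> bool" where
  "sum_of_squares_polynomial f \<longleftrightarrow>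
     (\<exists>(m::nat) g. (\<forall>k<m. real_polynomial_function (g k)) \<and> (\<forall>z. f z = (\<Sum>k<m. (g k z)\<^sup>2)))"

end

theory Submission
  imports Defs
begin

text \<open>
  Both \<open>x - \<alpha> i - \<beta> j\<close> and \<open>x - \<alpha> i * \<beta> j\<close> are matrices \<open>M\<close> of rank at most two, and the finite free
  convolutions are their normalised permanents; for the squares \<open>p\<^sup>2\<close>, \<open>q\<^sup>2\<close> every row and column is
  doubled. Writing \<open>f \<sigma> = (\<Prod>i. M i (\<sigma> i))\<close>, the doubled permanent is
  \<open>4^n * (\<Sum>\<sigma> \<rho>. f \<sigma> * f (\<sigma> \<circ> \<rho>) / N \<rho>)\<close>, where \<open>N \<rho> = 2^c\<close> for \<open>c\<close> the number of cycles of \<open>\<rho>\<close>.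
  So the difference is a quadratic form in the vector \<open>f\<close>, and it suffices that this form is
  nonnegative on a linear subspace containing all such \<open>f\<close>: it is then a sum of squares of linear
  functionals of \<open>f\<close>, whose entries are polynomials.

  On the whole group algebra the form is indefinite. Rank two means that antisymmetrising \<open>f\<close> over any three
  points gives \<open>0\<close>, i.e. only the representations of \<open>S\<^sub>n\<close> with at most two rows occur. There
  \<open>\<Sum>\<rho>. \<rho> / N \<rho> = (\<Prod>k. 1/2 + J k)\<close> with the Jucys-Murphy elements \<open>J k\<close> has the eigenvalue
  \<open>\<Prod>(1/2 + content)\<close>, in which exactly one factor is negative unless the representation is
  trivial. This is turned into an induction on \<open>n\<close> that avoids representation theory.
\<close>

section \<open>Operators on functions of permutations\<close>

text \<open>Vectors are indexed by all self-maps of \<open>'a\<close> so that they form a Euclidean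
  space; those of interest vanish off the permutations. Precomposing the index gives a left action
  of the symmetric group.\<close>

definition right_translate :: "('a::finite \<Rightarrow> 'a) \<Rightarrow> real ^ ('a \<Rightarrow> 'a) \<Rightarrow> real ^ ('a \<Rightarrow> 'a)" where
  "right_translate \<rho> w = (\<chi> \<sigma>. w $ (\<sigma> \<circ> \<rho>))"

lemma right_translate_id [simp]: "right_translate id w = w"
  by (simp add: right_translate_def vec_eq_iff)

lemma right_translate_comp: "right_translate \<sigma> (right_translate \<rho> w) = right_translate (\<sigma> \<circ> \<rho>) w"
  by (simp add: right_translate_def comp_assoc)

lemma linear_right_translate: "linear (right_translate \<rho>)"
  by (auto intro!: linearI simp: right_translate_def vec_eq_iff)

lemma inner_right_translate:
  assumes "bij \<rho>"
  shows "right_translate \<rho> w \<bullet> v = w \<bullet> right_translate (inv \<rho>) v"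
proof -
  have cancel: "\<rho> \<circ> inv \<rho> = id" "inv \<rho> \<circ> \<rho> = id"
    using assms by (simp_all add: bij_is_surj bij_is_inj surj_iff[symmetric])
  have "bij (\<lambda>\<sigma>::'a \<Rightarrow> 'a. \<sigma> \<circ> \<rho>)"
    by (rule bij_betw_byWitness[where f' = "\<lambda>\<sigma>. \<sigma> \<circ> inv \<rho>"]) (auto simp: comp_assoc cancel)
  then have "(\<Sum>\<sigma>\<in>UNIV. w $ (\<sigma> \<circ> \<rho>) * v $ (\<sigma> \<circ> \<rho> \<circ> inv \<rho>)) = (\<Sum>\<sigma>\<in>UNIV. w $ \<sigma> * v $ (\<sigma> \<circ> inv \<rho>))"
    by (rule sum.reindex_bij_betw)
  then show ?thesis
    by (simp add: inner_vec_def right_translate_def comp_assoc cancel)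
qed

text \<open>The number of invariant sets of a permutation of \<open>A\<close> is \<open>2\<close> to the number of its cycles on \<open>A\<close>.\<close>

definition invariant_sets :: "'a set \<Rightarrow> ('a \<Rightarrow> 'a) \<Rightarrow> 'a set set" where
  "invariant_sets A \<rho> = {E. E \<subseteq> A \<and> (\<forall>x\<in>A. \<rho> x \<in> E \<longleftrightarrow> x \<in> E)}"

definition sym_sum :: "'a::finite set \<Rightarrow> real ^ ('a \<Rightarrow> 'a) \<Rightarrow> real ^ ('a \<Rightarrow> 'a)" where
  "sym_sum A w = (\<Sum>\<rho> | \<rho> permutes A. right_translate \<rho> w)"

definition cycle_sum :: "'a::finite set \<Rightarrow> real ^ ('a \<Rightarrow> 'a) \<Rightarrow> real ^ ('a \<Rightarrow> 'a)" where
  "cycle_sum A w = (\<Sum>\<rho> | \<rho> permutes A. inverse (real (card (invariant_sets A \<rho>))) *\<^sub>R right_translate \<rho> w)"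

text \<open>The Jucys-Murphy element of the point \<open>a\<close> over \<open>A\<close>, meant for \<open>a \<notin> A\<close>.\<close>

definition jm_sum :: "'a::finite \<Rightarrow> 'a set \<Rightarrow> real ^ ('a \<Rightarrow> 'a) \<Rightarrow> real ^ ('a \<Rightarrow> 'a)" where
  "jm_sum a A w = (\<Sum>i\<in>A. right_translate (Transposition.transpose i a) w)"

text \<open>The factor 1/2 passes from ordered to unordered pairs: this is the Laplacian of the
  Cayley graph generated by the transpositions of \<open>A\<close>.\<close>

definition laplacian :: "'a::finite set \<Rightarrow> real ^ ('a \<Rightarrow> 'a) \<Rightarrow> real ^ ('a \<Rightarrow> 'a)" where
  "laplacian A w = (1/2) *\<^sub>R (\<Sum>i\<in>A. \<Sum>j\<in>A. w - right_translate (Transposition.transpose i j) w)"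

text \<open>The eigenvalue of \<open>cycle_sum A\<close> on vectors fixed by the permutations of
  \<open>A\<close>; it equals the product of \<open>k + 1/2\<close> over
  \<open>k < card A\<close>.\<close>

definition cycle_weight :: "'a::finite set \<Rightarrow> real" where
  "cycle_weight A = (\<Sum>\<rho> | \<rho> permutes A. inverse (real (card (invariant_sets A \<rho>))))"

lemma linear_sym_sum: "linear (sym_sum A)"
  unfolding sym_sum_def by (intro linear_compose_sum ballI linear_right_translate)

lemma linear_cycle_sum: "linear (cycle_sum A)"
  unfolding cycle_sum_def
  by (intro linear_compose_sum ballI linear_compose_scale_right linear_right_translate)

lemma linear_jm_sum: "linear (jm_sum a A)"
  unfolding jm_sum_def by (intro linear_compose_sum ballI linear_right_translate)

lemma linear_laplacian: "linear (laplacian A)"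
  unfolding laplacian_def
  by (intro linear_compose_sum ballI linear_compose_scale_right linear_compose_sub linear_right_translate linear_ident)

section \<open>Commutation with the permutations of \<open>A\<close>\<close>

lemma comp_transpose: "inj \<rho> \<Longrightarrow> \<rho> \<circ> Transposition.transpose i j = Transposition.transpose (\<rho> i) (\<rho> j) \<circ> \<rho>"
  by (auto simp: fun_eq_iff Transposition.transpose_def dest: injD)

text \<open>Conjugation by \<open>\<rho>\<close> fixes \<open>a\<close> and only permutes the
  transpositions \<open>(i a)\<close> among themselves.\<close>

lemma jm_sum_commute:
  assumes "\<rho> permutes A" "a \<notin> A"
  shows "right_translate \<rho> (jm_sum a A w) = jm_sum a A (right_translate \<rho> w)"
proof -
  have "right_translate \<rho> (jm_sum a A w) = (\<Sum>i\<in>A. right_translate (\<rho> \<circ> Transposition.transpose i a) w)"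
    by (simp add: jm_sum_def linear_sum[OF linear_right_translate] right_translate_comp)
  also have "\<dots> = (\<Sum>i\<in>A. right_translate (Transposition.transpose (\<rho> i) a) (right_translate \<rho> w))"
    using assms by (simp add: comp_transpose permutes_inj permutes_not_in right_translate_comp)
  also have "\<dots> = (\<Sum>i\<in>A. right_translate (Transposition.transpose i a) (right_translate \<rho> w))"
    using assms(1) by (intro sum.reindex_bij_betw permutes_imp_bij)
  finally show ?thesis
    by (simp add: jm_sum_def)
qed

lemma laplacian_commute:
  assumes "\<rho> permutes A"
  shows "right_translate \<rho> (laplacian A w) = laplacian A (right_translate \<rho> w)"
proof -
  let ?R = right_translate
  have "?R \<rho> (laplacian A w) = (1/2) *\<^sub>R (\<Sum>i\<in>A. \<Sum>j\<in>A. ?R \<rho> w - ?R (\<rho> \<circ> Transposition.transpose i j) w)"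
    by (simp add: laplacian_def linear_sum[OF linear_right_translate]
        linear_cmul[OF linear_right_translate] linear_diff[OF linear_right_translate] right_translate_comp)
  also have "\<dots> = (1/2) *\<^sub>R (\<Sum>i\<in>A. \<Sum>j\<in>A. ?R \<rho> w - ?R (Transposition.transpose (\<rho> i) (\<rho> j)) (?R \<rho> w))"
    using assms by (simp add: comp_transpose permutes_inj right_translate_comp)
  also have "(\<Sum>i\<in>A. \<Sum>j\<in>A. ?R \<rho> w - ?R (Transposition.transpose (\<rho> i) (\<rho> j)) (?R \<rho> w))
      = (\<Sum>i\<in>A. \<Sum>j\<in>A. ?R \<rho> w - ?R (Transposition.transpose (\<rho> i) j) (?R \<rho> w))"
    using assms by (intro sum.cong refl sum.reindex_bij_betw permutes_imp_bij)
  also have "\<dots> = (\<Sum>i\<in>A. \<Sum>j\<in>A. ?R \<rho> w - ?R (Transposition.transpose i j) (?R \<rho> w))"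
    using assms by (intro sum.reindex_bij_betw[where g = "\<lambda>i. \<Sum>j\<in>A. ?R \<rho> w - ?R (Transposition.transpose i j) (?R \<rho> w)"] permutes_imp_bij)
  finally show ?thesis
    by (simp add: laplacian_def)
qed

lemma cycle_sum_commute:
  assumes "linear L" "\<And>\<rho> w. \<rho> permutes A \<Longrightarrow> right_translate \<rho> (L w) = L (right_translate \<rho> w)"
  shows "cycle_sum A (L w) = L (cycle_sum A w)"
  using assms by (simp add: cycle_sum_def linear_sum linear_cmul)

lemma sym_sum_commute:
  assumes "linear L" "\<And>\<rho> w. \<rho> permutes A \<Longrightarrow> right_translate \<rho> (L w) = L (right_translate \<rho> w)"
  shows "sym_sum A (L w) = L (sym_sum A w)"
  using assms by (simp add: sym_sum_def linear_sum)

section \<open>Self-adjointness of the operators\<close>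

lemma inner_jm_sum: "jm_sum a A w \<bullet> v = w \<bullet> jm_sum a A v"
  by (simp add: jm_sum_def inner_sum_left inner_sum_right inner_right_translate)

lemma inner_laplacian: "laplacian A w \<bullet> v = w \<bullet> laplacian A v"
  by (simp add: laplacian_def inner_sum_left inner_sum_right inner_diff inner_right_translate)

lemma inner_sym_sum: "sym_sum A w \<bullet> v = w \<bullet> sym_sum A v"
proof -
  have "sym_sum A w \<bullet> v = (\<Sum>\<rho> | \<rho> permutes A. w \<bullet> right_translate (inv \<rho>) v)"
    by (simp add: sym_sum_def inner_sum_left inner_right_translate permutes_bij)
  then show ?thesis
    by (simp add: sum_permutations_inverse[of "\<lambda>\<rho>. w \<bullet> right_translate \<rho> v"] sym_sum_def inner_sum_right)
qed

lemma invariant_sets_inv: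
  assumes "\<rho> permutes A"
  shows "invariant_sets A (inv \<rho>) = invariant_sets A \<rho>"
  unfolding invariant_sets_def using assms
  by (metis (no_types, lifting) permutes_in_image permutes_inverses permutes_inv)

text \<open>A permutation and its inverse have the same invariant sets, hence the same
  weight.\<close>

lemma inner_cycle_sum: "cycle_sum A w \<bullet> v = w \<bullet> cycle_sum A v"
proof -
  define h where "h \<rho> = inverse (real (card (invariant_sets A \<rho>))) * (w \<bullet> right_translate \<rho> v)" for \<rho>
  have "cycle_sum A w \<bullet> v = (\<Sum>\<rho> | \<rho> permutes A. h (inv \<rho>))"
    by (simp add: cycle_sum_def inner_sum_left inner_right_translate permutes_bij h_def invariant_sets_inv)
  also have "\<dots> = (\<Sum>\<rho> | \<rho> permutes A. h \<rho>)"
    by (rule sum_permutations_inverse[symmetric])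
  finally show ?thesis
    by (simp add: cycle_sum_def inner_sum_right h_def)
qed

section \<open>Recursion when a point is added to the set\<close>

lemma laplacian_insert:
  assumes "a \<notin> A"
  shows "laplacian (insert a A) w = laplacian A w + real (card A) *\<^sub>R w - jm_sum a A w"
proof -
  let ?h = "\<lambda>i j. w - right_translate (Transposition.transpose i j) w"
  have sym: "?h a i = ?h i a" for i
    by (simp add: transpose_commute)
  have "(\<Sum>i\<in>insert a A. \<Sum>j\<in>insert a A. ?h i j) = (\<Sum>i\<in>A. \<Sum>j\<in>A. ?h i j) + 2 *\<^sub>R (\<Sum>i\<in>A. ?h i a)"
    using assms by (simp add: sum.distrib sym scaleR_2)
  moreover have "(\<Sum>i\<in>A. ?h i a) = real (card A) *\<^sub>R w - jm_sum a A w"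
    by (simp add: sum_subtractf jm_sum_def sum_constant_scaleR del: sum_constant)
  ultimately show ?thesis
    by (simp add: laplacian_def scaleR_add_right)
qed

text \<open>Coset decomposition: each permutation of the larger set is uniquely
  \<open>\<rho>\<close> or \<open>(i a) \<circ> \<rho>\<close> with \<open>\<rho>\<close> permuting
  \<open>A\<close>. Through it the group sums factor into Jucys-Murphy elements.\<close>

lemma sum_permutations_insert:
  fixes h :: "('a::finite \<Rightarrow> 'a) \<Rightarrow> 'b::comm_monoid_add"
  assumes "a \<notin> A"
  shows "(\<Sum>\<rho> | \<rho> permutes insert a A. h \<rho>) =
    (\<Sum>\<rho> | \<rho> permutes A. h \<rho>) + (\<Sum>i\<in>A. \<Sum>\<rho> | \<rho> permutes A. h (Transposition.transpose i a \<circ> \<rho>))"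
proof -
  have "(\<Sum>\<rho> | \<rho> permutes insert a A. h \<rho>) = (\<Sum>b\<in>insert a A. \<Sum>q | q permutes A. h (Transposition.transpose a b \<circ> q))"
    using assms by (intro sum_over_permutations_insert) auto
  then show ?thesis
    using assms by (simp add: transpose_commute[of a])
qed

lemma sym_sum_insert:
  assumes "a \<notin> A"
  shows "sym_sum (insert a A) w = sym_sum A w + jm_sum a A (sym_sum A w)"
  using assms
  by (simp add: sym_sum_def jm_sum_def sum_permutations_insert right_translate_comp
      linear_sum[OF linear_right_translate])

lemma card_invariant_sets_insert_fixed:
  fixes A :: "'a::finite set"
  assumes "a \<notin> A" "\<rho> permutes A"
  shows "card (invariant_sets (insert a A) \<rho>) = 2 * card (invariant_sets A \<rho>)"
proof -
  have "invariant_sets (insert a A) \<rho> = invariant_sets A \<rho> \<union> insert a ` invariant_sets A \<rho>"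
  proof (intro set_eqI iffI)
    fix E assume E: "E \<in> invariant_sets (insert a A) \<rho>"
    then have "E - {a} \<in> invariant_sets A \<rho>"
      using assms unfolding invariant_sets_def by (auto simp: permutes_in_image)
    moreover have "E = E - {a} \<or> E = insert a (E - {a})"
      by auto
    ultimately show "E \<in> invariant_sets A \<rho> \<union> insert a ` invariant_sets A \<rho>"
      by (metis UnI1 UnI2 imageI)
  next
    fix E assume "E \<in> invariant_sets A \<rho> \<union> insert a ` invariant_sets A \<rho>"
    then show "E \<in> invariant_sets (insert a A) \<rho>"
      using assms permutes_not_in[OF assms(2,1)] unfolding invariant_sets_def
      by (auto simp: permutes_in_image)
  qed
  moreover have "invariant_sets A \<rho> \<inter> insert a ` invariant_sets A \<rho> = {}"
    using assms by (auto simp: invariant_sets_def)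
  moreover have "inj_on (insert a) (invariant_sets A \<rho>)"
    using assms by (auto simp: invariant_sets_def intro!: inj_onI)
  ultimately show ?thesis
    by (simp add: card_Un_disjoint card_image)
qed

text \<open>The transposition splices \<open>a\<close> into the cycle of \<open>b\<close>, directly
  before \<open>b\<close>, and creates no new cycle. So an invariant set contains \<open>a\<close>
  iff it contains \<open>b\<close>, and deleting \<open>a\<close> loses nothing.\<close>

lemma card_invariant_sets_insert_transpose:
  fixes A :: "'a::finite set"
  assumes "a \<notin> A" "\<rho> permutes A" "b \<in> A"
  shows "card (invariant_sets (insert a A) (Transposition.transpose b a \<circ> \<rho>)) = card (invariant_sets A \<rho>)"
proof -
  note pa = permutes_not_in[OF assms(2,1)]
  have neq: "\<rho> x \<noteq> a" if "x \<in> A" for x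
    using that assms permutes_in_image by metis
  have "bij_betw (\<lambda>E. E - {a}) (invariant_sets (insert a A) (Transposition.transpose b a \<circ> \<rho>)) (invariant_sets A \<rho>)"
  proof (rule bij_betw_byWitness[where f' = "\<lambda>F. if b \<in> F then insert a F else F"])
    show "\<forall>E\<in>invariant_sets (insert a A) (Transposition.transpose b a \<circ> \<rho>).
        (if b \<in> E - {a} then insert a (E - {a}) else E - {a}) = E"
      using assms pa by (auto simp: invariant_sets_def)
    show "\<forall>F\<in>invariant_sets A \<rho>. (if b \<in> F then insert a F else F) - {a} = F"
      using assms by (auto simp: invariant_sets_def)
    show "(\<lambda>E. E - {a}) ` invariant_sets (insert a A) (Transposition.transpose b a \<circ> \<rho>) \<subseteq> invariant_sets A \<rho>"
    proof safe
      fix E assume "E \<in> invariant_sets (insert a A) (Transposition.transpose b a \<circ> \<rho>)"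
      then have E: "E \<subseteq> insert a A" "b \<in> E \<longleftrightarrow> a \<in> E"
        and inv: "\<And>x. x \<in> A \<Longrightarrow> Transposition.transpose b a (\<rho> x) \<in> E \<longleftrightarrow> x \<in> E"
        using pa by (auto simp: invariant_sets_def)
      have "\<rho> x \<in> E \<longleftrightarrow> x \<in> E" if "x \<in> A" for x
        using inv[OF that] neq[OF that] E(2) by (cases "\<rho> x = b") (auto simp: Transposition.transpose_def)
      then show "E - {a} \<in> invariant_sets A \<rho>"
        using E(1) neq assms(1) by (auto simp: invariant_sets_def)
    qed
    show "(\<lambda>F. if b \<in> F then insert a F else F) ` invariant_sets A \<rho>
        \<subseteq> invariant_sets (insert a A) (Transposition.transpose b a \<circ> \<rho>)"
    proof safe
      fix F assume "F \<in> invariant_sets A \<rho>"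
      then have F: "F \<subseteq> A" "\<And>x. x \<in> A \<Longrightarrow> \<rho> x \<in> F \<longleftrightarrow> x \<in> F"
        by (auto simp: invariant_sets_def)
      let ?E = "if b \<in> F then insert a F else F"
      have "Transposition.transpose b a (\<rho> x) \<in> ?E \<longleftrightarrow> x \<in> ?E" if "x \<in> A" for x
      proof (cases "\<rho> x = b")
        case True
        then show ?thesis using F(2)[OF that] that assms(1) F(1) by (auto simp: Transposition.transpose_def)
      next
        case False
        then show ?thesis using F(2)[OF that] that neq[OF that] assms(1) F(1)
          by (auto simp: Transposition.transpose_def)
      qed
      moreover have "Transposition.transpose b a (\<rho> a) \<in> ?E \<longleftrightarrow> a \<in> ?E"
        using pa F(1) assms by (auto simp: Transposition.transpose_def)
      ultimately show "?E \<in> invariant_sets (insert a A) (Transposition.transpose b a \<circ> \<rho>)"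
        using F(1) by (auto simp: invariant_sets_def)
    qed
  qed
  then show ?thesis
    by (rule bij_betw_same_card)
qed

text \<open>The new factor is \<open>1/2 + J\<close>: a fixed point is an extra cycle and halves the
  weight, while a spliced point leaves it unchanged.\<close>

lemma cycle_sum_insert:
  assumes "a \<notin> A"
  shows "cycle_sum (insert a A) w = (1/2) *\<^sub>R cycle_sum A w + jm_sum a A (cycle_sum A w)"
  using assms
  by (simp add: cycle_sum_def jm_sum_def sum_permutations_insert right_translate_comp[symmetric]
      linear_sum[OF linear_right_translate] linear_cmul[OF linear_right_translate]
      card_invariant_sets_insert_fixed card_invariant_sets_insert_transpose scaleR_sum_right)

lemma cycle_weight_insert:
  assumes "a \<notin> A"
  shows "cycle_weight (insert a A) = (1/2 + real (card A)) * cycle_weight A"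
  using assms
  by (simp add: cycle_weight_def sum_permutations_insert distrib_right sum_distrib_left sum.distrib
      card_invariant_sets_insert_fixed card_invariant_sets_insert_transpose)

text \<open>The product of the factors \<open>k + 1/2\<close>, in the form that later matches the
  number of permutations of the doubled set.\<close>

lemma cycle_weight_eq: "cycle_weight A * (4 ^ card A * fact (card A)) = fact (2 * card A)"
  using finite[of A]
proof (induction A rule: finite_induct)
  case empty
  have "invariant_sets {} \<rho> = {{}}" for \<rho> :: "'a \<Rightarrow> 'a"
    by (auto simp: invariant_sets_def)
  then show ?case
    by (simp add: cycle_weight_def)
next
  case (insert a A)
  have c: "card (insert a A) = Suc (card A)"
    using insert.hyps by simp
  have 1: "(1/2 + r) * x * (4 * p * ((1 + r) * f)) = x * (p * f) * ((2 * r + 1) * (2 * r + 2))" for r x p f :: real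
    by (simp add: algebra_simps)
  have "cycle_weight (insert a A) * (4 ^ card (insert a A) * fact (card (insert a A)))
     = cycle_weight A * (4 ^ card A * fact (card A)) * ((2 * real (card A) + 1) * (2 * real (card A) + 2))"
    by (simp only: c cycle_weight_insert[OF insert.hyps(2)] power_Suc fact_Suc of_nat_Suc 1)
  also have "\<dots> = fact (2 * card A) * ((2 * real (card A) + 1) * (2 * real (card A) + 2))"
    by (simp only: insert.IH)
  also have "\<dots> = fact (Suc (Suc (2 * card A)))"
    by (simp only: fact_Suc of_nat_Suc of_nat_mult) (simp add: ac_simps)
  also have "Suc (Suc (2 * card A)) = 2 * card (insert a A)"
    by (simp add: c)
  finally show ?case .
qed

section \<open>The subspace attached to rank two matrices\<close>

text \<open>The condition says that antisymmetrising over any three points gives \<open>0\<close>.\<close>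

definition two_row :: "(real ^ ('a::finite \<Rightarrow> 'a)) set" where
  "two_row = {w. \<forall>i j k. i \<noteq> j \<longrightarrow> j \<noteq> k \<longrightarrow> i \<noteq> k \<longrightarrow>
     w - right_translate (Transposition.transpose i j) w - right_translate (Transposition.transpose i k) w
       - right_translate (Transposition.transpose j k) w
       + right_translate (Transposition.transpose i k \<circ> Transposition.transpose j k) w
       + right_translate (Transposition.transpose j k \<circ> Transposition.transpose i k) w = 0}"

lemma subspace_two_row: "subspace two_row"
proof (rule subspaceI)
  let ?R = right_translate and ?t = Transposition.transpose
  fix x y :: "real ^ ('a \<Rightarrow> 'a)" and c :: real
  show "0 \<in> (two_row :: (real ^ ('a \<Rightarrow> 'a)) set)"
    by (simp add: two_row_def linear_0[OF linear_right_translate])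
  assume x: "x \<in> two_row"
  {
    assume y: "y \<in> two_row"
    show "x + y \<in> two_row"
      unfolding two_row_def
    proof (intro CollectI allI impI)
      fix i j k :: 'a assume "i \<noteq> j" "j \<noteq> k" "i \<noteq> k"
      with x y have
        "x - ?R (?t i j) x - ?R (?t i k) x - ?R (?t j k) x + ?R (?t i k \<circ> ?t j k) x + ?R (?t j k \<circ> ?t i k) x = 0"
        "y - ?R (?t i j) y - ?R (?t i k) y - ?R (?t j k) y + ?R (?t i k \<circ> ?t j k) y + ?R (?t j k \<circ> ?t i k) y = 0"
        unfolding two_row_def by blast+
      from arg_cong2[OF this, of "(+)"]
      show "x + y - ?R (?t i j) (x + y) - ?R (?t i k) (x + y) - ?R (?t j k) (x + y)
          + ?R (?t i k \<circ> ?t j k) (x + y) + ?R (?t j k \<circ> ?t i k) (x + y) = 0"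
        by (simp add: linear_add[OF linear_right_translate] algebra_simps)
    qed
  }
  show "c *\<^sub>R x \<in> two_row"
    unfolding two_row_def
  proof (intro CollectI allI impI)
    fix i j k :: 'a assume "i \<noteq> j" "j \<noteq> k" "i \<noteq> k"
    with x have
      "x - ?R (?t i j) x - ?R (?t i k) x - ?R (?t j k) x + ?R (?t i k \<circ> ?t j k) x + ?R (?t j k \<circ> ?t i k) x = 0"
      unfolding two_row_def by blast
    from arg_cong[OF this, of "scaleR c"]
    show "c *\<^sub>R x - ?R (?t i j) (c *\<^sub>R x) - ?R (?t i k) (c *\<^sub>R x) - ?R (?t j k) (c *\<^sub>R x)
        + ?R (?t i k \<circ> ?t j k) (c *\<^sub>R x) + ?R (?t j k \<circ> ?t i k) (c *\<^sub>R x) = 0"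
      by (simp add: linear_cmul[OF linear_right_translate] algebra_simps)
  qed
qed

text \<open>Moving \<open>\<rho>\<close> past the transpositions reduces the relation for
  \<open>i\<close>, \<open>j\<close>, \<open>k\<close> to the one for their preimages under
  \<open>\<rho>\<close>.\<close>

lemma right_translate_two_row:
  assumes "w \<in> two_row" "bij \<rho>"
  shows "right_translate \<rho> w \<in> two_row"
  unfolding two_row_def
proof (intro CollectI allI impI)
  let ?R = right_translate and ?t = Transposition.transpose
  fix i j k :: 'a assume ijk: "i \<noteq> j" "j \<noteq> k" "i \<noteq> k"
  define i' j' k' where "i' = inv \<rho> i" and "j' = inv \<rho> j" and "k' = inv \<rho> k"
  have \<rho>: "\<rho> i' = i" "\<rho> j' = j" "\<rho> k' = k"
    using assms(2) by (simp_all add: i'_def j'_def k'_def bij_is_surj surj_f_inv_f)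
  have "i' \<noteq> j'" "j' \<noteq> k'" "i' \<noteq> k'"
    using \<rho> ijk by auto
  with assms(1) have "w - ?R (?t i' j') w - ?R (?t i' k') w - ?R (?t j' k') w
      + ?R (?t i' k' \<circ> ?t j' k') w + ?R (?t j' k' \<circ> ?t i' k') w = 0"
    unfolding two_row_def by blast
  then have "?R \<rho> (w - ?R (?t i' j') w - ?R (?t i' k') w - ?R (?t j' k') w
      + ?R (?t i' k' \<circ> ?t j' k') w + ?R (?t j' k' \<circ> ?t i' k') w) = 0"
    by (simp add: linear_0[OF linear_right_translate])
  moreover have c: "?t i j \<circ> \<rho> = \<rho> \<circ> ?t i' j'" "?t i k \<circ> \<rho> = \<rho> \<circ> ?t i' k'" "?t j k \<circ> \<rho> = \<rho> \<circ> ?t j' k'"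
    using assms(2) by (simp_all add: comp_transpose bij_is_inj \<rho>)
  moreover have "?t i k \<circ> ?t j k \<circ> \<rho> = \<rho> \<circ> (?t i' k' \<circ> ?t j' k')"
    "?t j k \<circ> ?t i k \<circ> \<rho> = \<rho> \<circ> (?t j' k' \<circ> ?t i' k')"
    by (metis c comp_assoc)+
  ultimately show "?R \<rho> w - ?R (?t i j) (?R \<rho> w) - ?R (?t i k) (?R \<rho> w) - ?R (?t j k) (?R \<rho> w)
      + ?R (?t i k \<circ> ?t j k) (?R \<rho> w) + ?R (?t j k \<circ> ?t i k) (?R \<rho> w) = 0"
    by (simp only: linear_add[OF linear_right_translate] linear_diff[OF linear_right_translate]
        right_translate_comp)
qed

lemma jm_sum_two_row: "w \<in> two_row \<Longrightarrow> jm_sum a A w \<in> two_row"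
  unfolding jm_sum_def by (intro subspace_sum subspace_two_row right_translate_two_row) auto

lemma laplacian_two_row: "w \<in> two_row \<Longrightarrow> laplacian A w \<in> two_row"
  unfolding laplacian_def
  by (intro subspace_sum subspace_scale subspace_diff subspace_two_row right_translate_two_row) auto

lemma sym_sum_two_row: "w \<in> two_row \<Longrightarrow> sym_sum A w \<in> two_row"
  unfolding sym_sum_def
  by (intro subspace_sum subspace_two_row right_translate_two_row) (auto simp: permutes_bij)

lemma two_rowD:
  assumes "w \<in> two_row" "i \<noteq> j" "j \<noteq> k" "i \<noteq> k"
  shows "w - right_translate (Transposition.transpose i j) w - right_translate (Transposition.transpose i k) w
       - right_translate (Transposition.transpose j k) w
       + right_translate (Transposition.transpose i k \<circ> Transposition.transpose j k) w
       + right_translate (Transposition.transpose j k \<circ> Transposition.transpose i k) w = 0"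
  using assms unfolding two_row_def by blast

lemma six_term_rearrange:
  fixes w x y z p q :: "'v::ab_group_add"
  assumes "w - x - y - z + p + q = 0"
  shows "p + q = - (w - x) + (y + (z + 0))"
proof -
  have "p + q = (w - x - y - z + p + q) - (w - x - y - z)"
    by (simp add: algebra_simps)
  then show ?thesis
    unfolding assms by (simp add: algebra_simps)
qed

lemma double_eq_solve:
  fixes S G J w :: "'v::real_vector"
  assumes "2 *\<^sub>R S = - (2 *\<^sub>R G) + (c *\<^sub>R J + (c *\<^sub>R J + 2 *\<^sub>R (c *\<^sub>R w - J)))"
  shows "S = (c - 1) *\<^sub>R J + c *\<^sub>R w - G"
proof -
  have "S = (1/2) *\<^sub>R (2 *\<^sub>R S)"
    by simp
  also have "\<dots> = (c - 1) *\<^sub>R J + c *\<^sub>R w - G"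
    unfolding assms
    by (simp add: scaleR_add_right scaleR_diff_right scaleR_left_diff_distrib)
      (simp flip: scaleR_left_distrib)
  finally show ?thesis .
qed

text \<open>Squaring produces the products \<open>(i a) (j a)\<close>, which are 3-cycles for
  \<open>i \<noteq> j\<close>. The relation for \<open>i\<close>, \<open>j\<close>, \<open>a\<close>
  expresses the sum of two opposite 3-cycles by the identity and transpositions, so \<open>J\<close>
  satisfies a quadratic equation whose constant term involves the Laplacian.\<close>

lemma jm_sum_square:
  assumes "w \<in> two_row" "a \<notin> A"
  shows "jm_sum a A (jm_sum a A w) =
    (real (card A) - 1) *\<^sub>R jm_sum a A w + real (card A) *\<^sub>R w - laplacian A w"
proof -
  let ?R = right_translate and ?t = Transposition.transpose
  define P where "P i j = ?R (?t i a \<circ> ?t j a) w" for i j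
  define S where "S = (\<Sum>i\<in>A. \<Sum>j\<in>A. P i j)"
  define c where "c = real (card A)"
  have diag: "P i i = w" for i
    by (simp add: P_def)
  have J2: "jm_sum a A (jm_sum a A w) = S"
    by (simp add: S_def jm_sum_def linear_sum[OF linear_right_translate] right_translate_comp P_def)
  \<comment> \<open>The last summand repairs the diagonal, where both sides must be
    \<open>2 *\<^sub>R w\<close>; one formula can then be summed over all pairs.\<close>
  have rel: "P i j + P j i = - (w - ?R (?t i j) w) + (?R (?t i a) w + (?R (?t j a) w
      + (if i = j then 2 *\<^sub>R (w - ?R (?t i a) w) else 0)))" if "i \<in> A" "j \<in> A" for i j
  proof (cases "i = j")
    case True
    then show ?thesis by (simp add: diag scaleR_2)
  next
    case False
    then have "w - ?R (?t i j) w - ?R (?t i a) w - ?R (?t j a) w + P i j + P j i = 0"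
      unfolding P_def using assms that by (intro two_rowD) auto
    with False show ?thesis
      by (simp only: if_False) (rule six_term_rearrange)
  qed
  have "2 *\<^sub>R S = S + (\<Sum>i\<in>A. \<Sum>j\<in>A. P j i)"
    unfolding scaleR_2 S_def by (subst sum.swap) (rule refl)
  also have "\<dots> = (\<Sum>i\<in>A. \<Sum>j\<in>A. P i j + P j i)"
    by (simp only: S_def sum.distrib)
  also have "\<dots> = (\<Sum>i\<in>A. \<Sum>j\<in>A. - (w - ?R (?t i j) w) + (?R (?t i a) w + (?R (?t j a) w
      + (if i = j then 2 *\<^sub>R (w - ?R (?t i a) w) else 0))))"
    by (intro sum.cong refl rel)
  also have "\<dots> = - (\<Sum>i\<in>A. \<Sum>j\<in>A. w - ?R (?t i j) w) + ((\<Sum>i\<in>A. \<Sum>j\<in>A. ?R (?t i a) w)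
      + ((\<Sum>i\<in>A. \<Sum>j\<in>A. ?R (?t j a) w) + (\<Sum>i\<in>A. \<Sum>j\<in>A. if i = j then 2 *\<^sub>R (w - ?R (?t i a) w) else 0)))"
    by (simp only: sum.distrib sum_negf)
  also have "(\<Sum>i\<in>A. \<Sum>j\<in>A. w - ?R (?t i j) w) = 2 *\<^sub>R laplacian A w"
    by (simp add: laplacian_def)
  also have "(\<Sum>i\<in>A. \<Sum>j\<in>A. ?R (?t i a) w) = c *\<^sub>R jm_sum a A w"
    by (simp only: jm_sum_def sum_constant_scaleR scaleR_sum_right c_def)
  also have "(\<Sum>i\<in>A. \<Sum>j\<in>A. ?R (?t j a) w) = c *\<^sub>R jm_sum a A w"
    by (simp only: jm_sum_def sum_constant_scaleR c_def)
  also have "(\<Sum>i\<in>A. \<Sum>j\<in>A. if i = j then 2 *\<^sub>R (w - ?R (?t i a) w) else 0)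
      = (\<Sum>i\<in>A. 2 *\<^sub>R (w - ?R (?t i a) w))"
    by (intro sum.cong refl) simp
  also have "\<dots> = 2 *\<^sub>R (c *\<^sub>R w - jm_sum a A w)"
    by (simp only: jm_sum_def sum_constant_scaleR c_def sum_subtractf scaleR_sum_right[symmetric])
  finally have eq: "2 *\<^sub>R S = - (2 *\<^sub>R laplacian A w) + (c *\<^sub>R jm_sum a A w + (c *\<^sub>R jm_sum a A w
      + 2 *\<^sub>R (c *\<^sub>R w - jm_sum a A w)))" .
  show ?thesis
    unfolding J2 c_def[symmetric] using eq by (rule double_eq_solve)
qed

section \<open>Negativity outside the invariants\<close>

lemma laplacian_jm_sum:
  assumes "a \<notin> A"
  shows "laplacian A (jm_sum a A w) = jm_sum a A (laplacian A w)"
proof -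
  have "right_translate (Transposition.transpose i j) (jm_sum a A w)
      = jm_sum a A (right_translate (Transposition.transpose i j) w)" if "i \<in> A" "j \<in> A" for i j
    using that assms by (intro jm_sum_commute permutes_swap_id)
  then show ?thesis
    by (simp add: laplacian_def linear_sum[OF linear_jm_sum] linear_cmul[OF linear_jm_sum]
        linear_diff[OF linear_jm_sum])
qed

lemma right_translate_sym_sum:
  assumes "\<rho> permutes A"
  shows "right_translate \<rho> (sym_sum A w) = sym_sum A w"
proof -
  have "right_translate \<rho> (sym_sum A w) = (\<Sum>\<tau> | \<tau> permutes A. right_translate (\<rho> \<circ> \<tau>) w)"
    by (simp add: sym_sum_def linear_sum[OF linear_right_translate] right_translate_comp)
  also have "\<dots> = sym_sum A w"
    unfolding sym_sum_def using assms by (rule setum_permutations_compose_left[symmetric])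
  finally show ?thesis .
qed

text \<open>On invariant vectors each operator acts as the sum of its coefficients.\<close>

lemma invariant_operators:
  assumes "\<And>\<rho>. \<rho> permutes A \<Longrightarrow> right_translate \<rho> y = y"
  shows "sym_sum A y = fact (card A) *\<^sub>R y" "cycle_sum A y = cycle_weight A *\<^sub>R y" "laplacian A y = 0"
proof -
  have "right_translate (Transposition.transpose i j) y = y" if "i \<in> A" "j \<in> A" for i j
    using that by (intro assms permutes_swap_id)
  then show "laplacian A y = 0"
    by (simp add: laplacian_def)
qed (use assms in \<open>simp_all add: sym_sum_def cycle_sum_def cycle_weight_def scaleR_sum_left
      sum_constant_scaleR card_permutations del: sum_constant\<close>)

lemma cycle_weight_nonneg: "cycle_weight A \<ge> 0"
  unfolding cycle_weight_def by (intro sum_nonneg) auto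

text \<open>
  Let \<open>K\<close> be the cycle sum, \<open>J\<close> the Jucys-Murphy element of the new point, \<open>m = |A| - 1\<close> and
  \<open>H = laplacian - |A|\<close>. On \<open>two_row\<close> we have
  \<open>J * (m - J) = H\<close>, so multiplying by \<open>m\<close> writes each form needed below through forms of the
  induction hypothesis: \<open>m * K * J = J * K * J + K * H\<close>,
  \<open>m * K * (m - J) = (m - J) * K * (m - J) + K * H\<close> and \<open>m * K * H * J = J * K * H * J + H * K * H\<close>. The
  second conjunct is there because \<open>K * H\<close> occurs on the right.
\<close>

lemma cycle_sum_nonpos:
  assumes "w \<in> two_row" "sym_sum A w = 0"
  shows "w \<bullet> cycle_sum A w \<le> 0 \<and> w \<bullet> cycle_sum A (laplacian A w - real (card A) *\<^sub>R w) \<le> 0"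
  using finite[of A] assms
proof (induction A arbitrary: w rule: finite_induct)
  case empty
  then show ?case by (simp add: sym_sum_def)
next
  case (insert a A)
  let ?K = "cycle_sum A" and ?J = "jm_sum a A" and ?K' = "cycle_sum (insert a A)" and ?S = "sym_sum A"
  define H where "H x = laplacian A x - real (card A) *\<^sub>R x" for x
  define m where "m = real (card A) - 1"
  \<comment> \<open>The vectors to which the induction hypothesis applies; \<open>B\<close> is
    stable under \<open>J\<close> and \<open>H\<close>.\<close>
  define B where "B = {x \<in> two_row. ?S x = 0}"
  \<comment> \<open>The projection of \<open>w\<close> to the vectors fixed by the permutations of
    \<open>A\<close>; the remainder \<open>b\<close> lies in \<open>B\<close>.\<close>
  define y where "y = (1 / fact (card A)) *\<^sub>R ?S w"
  define b where "b = w - y"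
  note lin = linear_add linear_diff linear_cmul
  note J = lin[OF linear_jm_sum] and K = lin[OF linear_cycle_sum] and S = lin[OF linear_sym_sum]
    and G = lin[OF linear_laplacian]
  have invy: "right_translate \<rho> y = y" if "\<rho> permutes A" for \<rho>
    using that by (simp add: y_def linear_cmul[OF linear_right_translate] right_translate_sym_sum)
  note opy = invariant_operators[OF invy]
  have w: "w = y + b" by (simp add: b_def)
  \<comment> \<open>The hypothesis for the larger set forces \<open>J\<close> to act on
    \<open>y\<close> as \<open>-1\<close>, so there the new factor \<open>1/2 + J\<close> is
    \<open>-1/2\<close>.\<close>
  have "?S w + ?J (?S w) = 0"
    using insert.prems insert.hyps sym_sum_insert by metis
  then have "(1 / fact (card A)) *\<^sub>R (?S w + ?J (?S w)) = 0"
    by simp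
  then have Jy: "?J y = - y"
    by (simp add: y_def J scaleR_add_right add_eq_0_iff)
  have "?S b = 0"
    unfolding b_def by (simp add: S opy(1)) (simp add: y_def)
  moreover have "b \<in> two_row"
    unfolding b_def y_def
    by (intro subspace_diff subspace_scale subspace_two_row sym_sum_two_row insert.prems)
  ultimately have bB: "b \<in> B" by (simp add: B_def)
  have B_diff: "x - x' \<in> B" if "x \<in> B" "x' \<in> B" for x x'
    using that by (simp add: B_def S subspace_diff subspace_two_row)
  have B_add: "x + x' \<in> B" if "x \<in> B" "x' \<in> B" for x x'
    using that by (simp add: B_def S subspace_add subspace_two_row)
  have B_scale: "c *\<^sub>R x \<in> B" if "x \<in> B" for x c
    using that by (simp add: B_def S subspace_scale subspace_two_row)
  have B_J: "?J x \<in> B" if "x \<in> B" for x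
    using that insert.hyps
    by (simp add: B_def jm_sum_two_row sym_sum_commute[OF linear_jm_sum jm_sum_commute] linear_0[OF linear_jm_sum])
  have B_H: "H x \<in> B" if "x \<in> B" for x
    unfolding H_def using that
    by (intro B_diff B_scale)
      (simp_all add: B_def laplacian_two_row sym_sum_commute[OF linear_laplacian laplacian_commute] linear_0[OF linear_laplacian])
  have IH: "x \<bullet> ?K x \<le> 0" "x \<bullet> ?K (H x) \<le> 0" if "x \<in> B" for x
    using that insert.IH[of x] by (auto simp: B_def H_def)
  have yB: "y \<bullet> x = 0" if "x \<in> B" for x
    using that by (simp add: y_def inner_sym_sum B_def)
  have JJ: "?J (?J x) = m *\<^sub>R ?J x - H x" if "x \<in> B" for x
    using that insert.hyps by (simp add: B_def jm_sum_square m_def H_def algebra_simps)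
  have KJ: "?K (?J x) = ?J (?K x)" for x
    using insert.hyps by (intro cycle_sum_commute linear_jm_sum jm_sum_commute)
  have KG: "?K (laplacian A x) = laplacian A (?K x)" for x
    by (intro cycle_sum_commute linear_laplacian laplacian_commute)
  have qJ: "?J x \<bullet> ?K x' = x \<bullet> ?K (?J x')" for x x'
    by (simp add: KJ inner_jm_sum)
  have qH: "H x \<bullet> ?K x' = x \<bullet> ?K (H x')" for x x'
    by (simp add: H_def K KG inner_diff inner_laplacian)
  have sym: "x \<bullet> ?K x' = x' \<bullet> ?K x" for x x'
    by (metis inner_commute inner_cycle_sum)
  have HJ: "H (?J x) = ?J (H x)" for x
    using insert.hyps by (simp add: H_def J laplacian_jm_sum)
  have K': "x \<bullet> ?K' x' = (1/2) * (x \<bullet> ?K x') + ?J x \<bullet> ?K x'" for x x'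
    using insert.hyps by (simp add: cycle_sum_insert inner_add_right inner_jm_sum)
  have K'y: "?K' y = (- (1/2) * cycle_weight A) *\<^sub>R y"
    using insert.hyps by (simp add: cycle_sum_insert opy J Jy algebra_simps flip: scaleR_add_left)
  define z where "z = H b + (m *\<^sub>R b - ?J b)"
  have zB: "z \<in> B"
    unfolding z_def by (intro B_add B_diff B_scale B_J B_H bB)
  \<comment> \<open>On \<open>y\<close> the terms \<open>card A\<close>, \<open>- J\<close> and
    \<open>- card (insert a A)\<close> cancel and the Laplacian of \<open>A\<close> vanishes, so
    only \<open>b\<close> contributes.\<close>
  have zw: "laplacian (insert a A) w - real (card (insert a A)) *\<^sub>R w = z"
    using insert.hyps by (simp add: laplacian_insert w G J Jy opy z_def H_def m_def algebra_simps)
  have bK'b: "b \<bullet> ?K' b \<le> 0 \<and> b \<bullet> ?K' z \<le> 0"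
  \<comment> \<open>The division by \<open>m\<close> needs at least two points. With fewer,
    \<open>?S\<close> is the identity and \<open>B\<close> is trivial.\<close>
  proof (cases "card A \<le> 1")
    case True
    then consider "A = {}" | x where "A = {x}"
      by (metis card_0_eq card_1_singletonE finite le_0_eq le_Suc_eq One_nat_def)
    then have "b = 0"
      using bB by cases (simp_all add: B_def sym_sum_def permutes_sing)
    then show ?thesis by simp
  next
    case False
    then have m: "m > 0" by (simp add: m_def)
    have bHb: "b \<bullet> ?K (H b) \<le> 0"
      by (intro IH bB)
    have e1: "?J b \<bullet> ?K (?J b) = m * (b \<bullet> ?K (?J b)) - b \<bullet> ?K (H b)"
      by (simp add: qJ JJ bB K inner_diff_right)
    with IH(1)[OF B_J[OF bB]] bHb have "m * (b \<bullet> ?K (?J b)) \<le> 0" by linarith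
    then have bJb: "b \<bullet> ?K (?J b) \<le> 0"
      using m by (simp add: mult_le_0_iff)
    let ?x = "m *\<^sub>R b - ?J b"
    have e2: "?J b \<bullet> ?K ?x = b \<bullet> ?K (H b)"
      using e1 by (simp add: K inner_diff_right qJ)
    have "m * (b \<bullet> ?K ?x) = ?x \<bullet> ?K ?x + ?J b \<bullet> ?K ?x"
      by (simp add: inner_diff_left)
    moreover have "?x \<bullet> ?K ?x \<le> 0"
      by (intro IH B_diff B_scale B_J bB)
    ultimately have "m * (b \<bullet> ?K ?x) \<le> 0"
      using e2 bHb by linarith
    then have bx: "b \<bullet> ?K ?x \<le> 0"
      using m by (simp add: mult_le_0_iff)
    have "m * (?J b \<bullet> ?K (H b)) = (?J (?J b) + H b) \<bullet> ?K (H b)"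
      by (simp add: JJ bB)
    also have "\<dots> = ?J b \<bullet> ?K (H (?J b)) + H b \<bullet> ?K (H b)"
      by (simp add: inner_add_left qJ HJ)
    also have "\<dots> \<le> 0"
      by (intro add_nonpos_nonpos IH B_J B_H bB)
    finally have "?J b \<bullet> ?K (H b) \<le> 0"
      using m by (simp add: mult_le_0_iff)
    with bHb bx bJb IH(1)[OF bB] show ?thesis
      by (simp add: K' z_def linear_add[OF linear_cycle_sum] inner_add_right e2) (simp add: qJ)
  qed
  \<comment> \<open>No cross terms arise: \<open>y\<close> is an eigenvector of the self-adjoint
    \<open>?K'\<close> and is orthogonal to \<open>B\<close>.\<close>
  have yK': "y \<bullet> ?K' x = 0" if "x \<in> B" for x
    using that by (simp add: inner_cycle_sum[symmetric] K'y yB)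
  have "w \<bullet> ?K' w = y \<bullet> ?K' y + b \<bullet> ?K' y + (y \<bullet> ?K' b + b \<bullet> ?K' b)"
    by (simp add: w linear_add[OF linear_cycle_sum] inner_add_left inner_add_right)
  also have "\<dots> = - (1/2) * cycle_weight A * (y \<bullet> y) + b \<bullet> ?K' b"
    using bB by (simp add: yK' K'y yB inner_commute[of b])
  also have "\<dots> \<le> 0"
    using bK'b mult_nonneg_nonneg[OF cycle_weight_nonneg[of A] inner_ge_zero[of y]] by linarith
  finally have "w \<bullet> ?K' w \<le> 0" .
  moreover have "w \<bullet> ?K' z \<le> 0"
    using bK'b zB by (simp add: w inner_add_left yK')
  ultimately show ?case
    unfolding zw by (rule conjI)
qed

text \<open>Split \<open>w\<close> into its invariant part, where both sides agree, and the
  orthogonal rest, where \<open>sym_sum A\<close> vanishes and the form of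
  \<open>cycle_sum A\<close> is nonpositive.\<close>

lemma cycle_sum_le_sym_sum:
  assumes "w \<in> two_row"
  shows "w \<bullet> cycle_sum A w \<le> cycle_weight A / fact (card A) * (w \<bullet> sym_sum A w)"
proof -
  define y where "y = (1 / fact (card A)) *\<^sub>R sym_sum A w"
  define b where "b = w - y"
  have "right_translate \<rho> y = y" if "\<rho> permutes A" for \<rho>
    using that by (simp add: y_def linear_cmul[OF linear_right_translate] right_translate_sym_sum)
  note opy = invariant_operators[OF this]
  have Sb: "sym_sum A b = 0"
    unfolding b_def by (simp add: linear_diff[OF linear_sym_sum] opy(1)) (simp add: y_def)
  have "b \<in> two_row"
    unfolding b_def y_def by (intro subspace_diff subspace_scale subspace_two_row sym_sum_two_row assms)
  then have b: "b \<bullet> cycle_sum A b \<le> 0"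
    using cycle_sum_nonpos Sb by blast
  have yb: "y \<bullet> b = 0"
    by (simp add: y_def inner_sym_sum Sb)
  have w: "w = y + b" by (simp add: b_def)
  have "w \<bullet> cycle_sum A w = y \<bullet> cycle_sum A y + b \<bullet> cycle_sum A y + (cycle_sum A y \<bullet> b + b \<bullet> cycle_sum A b)"
    by (simp add: w linear_add[OF linear_cycle_sum] inner_add_left inner_add_right inner_cycle_sum)
  also have "\<dots> = cycle_weight A * (y \<bullet> y) + b \<bullet> cycle_sum A b"
    by (simp add: opy yb inner_commute[of b])
  also have "\<dots> \<le> cycle_weight A * (y \<bullet> y)"
    using b by simp
  also have "y \<bullet> y = y \<bullet> w"
    by (simp add: w inner_add_right yb)
  also have "y \<bullet> w = (w \<bullet> sym_sum A w) / fact (card A)"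
    by (simp add: y_def inner_commute[of w])
  finally show ?thesis by simp
qed

section \<open>Nonnegative forms and products along permutations\<close>

text \<open>Completing the square, by induction on the dimension. The functionals are linear on the
  whole space; only the identity is restricted to \<open>S\<close>.\<close>

lemma nonneg_form_sum_squares:
  fixes S :: "'a::euclidean_space set" and B :: "'a \<Rightarrow> 'a \<Rightarrow> real"
  assumes "subspace S" "bilinear B" "\<And>x y. B x y = B y x" "\<And>x. x \<in> S \<Longrightarrow> B x x \<ge> 0"
  shows "\<exists>(m::nat) l. (\<forall>k<m. linear (l k)) \<and> (\<forall>x\<in>S. B x x = (\<Sum>k<m. (l k x)\<^sup>2))"
  using assms(1,4)
proof (induction "dim S" arbitrary: S rule: less_induct)
  case less
  show ?case
  proof (cases "\<forall>x\<in>S. B x x = 0")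
    case True
    then show ?thesis by (intro exI[of _ 0]) auto
  next
    case False
    note Bs = bilinear_ladd[OF assms(2)] bilinear_radd[OF assms(2)] bilinear_lmul[OF assms(2)]
      bilinear_rmul[OF assms(2)] bilinear_lsub[OF assms(2)] bilinear_rsub[OF assms(2)] bilinear_lzero[OF assms(2)]
    from False obtain e0 where e0: "e0 \<in> S" "B e0 e0 > 0"
      using less.prems(2) by (metis order_le_less)
    define e where "e = (1 / sqrt (B e0 e0)) *\<^sub>R e0"
    have e: "e \<in> S" "B e e = 1"
      using e0 less.prems(1) by (simp_all add: e_def subspace_scale Bs)
    \<comment> \<open>The \<open>B\<close>-orthogonal complement of \<open>e\<close> in
      \<open>S\<close>. The map \<open>P\<close> below projects \<open>S\<close> to it, and the
      square split off is that of \<open>B x e\<close>.\<close>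
    define S' where "S' = {x \<in> S. B x e = 0}"
    have S': "subspace S'"
      using less.prems(1) by (auto simp: S'_def subspace_def Bs)
    have "e \<notin> S'"
      using e by (simp add: S'_def)
    then have "S' \<subset> S"
      using e(1) unfolding S'_def by blast
    then have "dim S' < dim S"
      using S' less.prems(1) by (intro dim_psubset) (simp add: span_eq_iff[THEN iffD2])
    from less.hyps[OF this S'] less.prems(2) obtain m :: nat and l
      where l: "\<And>k. k < m \<Longrightarrow> linear (l k)" "\<And>x. x \<in> S' \<Longrightarrow> B x x = (\<Sum>k<m. (l k x)\<^sup>2)"
      by (auto simp: S'_def)
    define P where "P x = x - B x e *\<^sub>R e" for x
    have P: "linear P"
      by (auto intro!: linearI simp: P_def Bs algebra_simps)
    define l' where "l' k = (if k < m then l k \<circ> P else (\<lambda>x. B x e))" for k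
    have "linear (l' k)" for k
      using assms(2) l(1)[of k] linear_compose[OF P] by (auto simp: l'_def bilinear_def)
    moreover have "B x x = (\<Sum>k<Suc m. (l' k x)\<^sup>2)" if "x \<in> S" for x
    proof -
      have "P x \<in> S'"
        using that e less.prems(1) by (simp add: P_def S'_def subspace_diff subspace_scale Bs)
      then have "B (P x) (P x) = (\<Sum>k<m. (l' k x)\<^sup>2)"
        by (simp add: l(2) l'_def)
      moreover have "B (P x) (P x) = B x x - (B x e)\<^sup>2"
        using e(2) assms(3)[of e x] by (simp add: P_def Bs power2_eq_square)
      ultimately show ?thesis by (simp add: l'_def)
    qed
    ultimately show ?thesis by blast
  qed
qed

definition permanent :: "'a set \<Rightarrow> ('a \<Rightarrow> 'a \<Rightarrow> real) \<Rightarrow> real" where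
  "permanent I M = (\<Sum>\<pi> | \<pi> permutes I. \<Prod>i\<in>I. M i (\<pi> i))"

definition perm_products :: "('a::finite \<Rightarrow> 'a \<Rightarrow> real) \<Rightarrow> real ^ ('a \<Rightarrow> 'a)" where
  "perm_products M = (\<chi> \<sigma>. if \<sigma> permutes UNIV then \<Prod>i\<in>UNIV. M i (\<sigma> i) else 0)"

lemma permutes_UNIV_comp_iff:
  assumes "\<rho> permutes UNIV"
  shows "(\<sigma> \<circ> \<rho>) permutes UNIV \<longleftrightarrow> \<sigma> permutes UNIV"
proof
  assume "(\<sigma> \<circ> \<rho>) permutes UNIV"
  then have "(\<sigma> \<circ> \<rho> \<circ> inv \<rho>) permutes UNIV"
    by (rule permutes_compose[OF permutes_inv[OF assms]])
  then show "\<sigma> permutes UNIV"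
    by (simp add: comp_assoc permutes_inv_o[OF assms])
qed (use assms permutes_compose in blast)

lemma rank_two_antisymmetrised:
  fixes a1 a2 b1 b2 c1 c2 x1 x2 y1 y2 z1 z2 :: real
  shows "(a1 * x1 + a2 * x2) * (b1 * y1 + b2 * y2) * (c1 * z1 + c2 * z2)
    - (a1 * y1 + a2 * y2) * (b1 * x1 + b2 * x2) * (c1 * z1 + c2 * z2)
    - (a1 * z1 + a2 * z2) * (b1 * y1 + b2 * y2) * (c1 * x1 + c2 * x2)
    - (a1 * x1 + a2 * x2) * (b1 * z1 + b2 * z2) * (c1 * y1 + c2 * y2)
    + (a1 * z1 + a2 * z2) * (b1 * x1 + b2 * x2) * (c1 * y1 + c2 * y2)
    + (a1 * y1 + a2 * y2) * (b1 * z1 + b2 * z2) * (c1 * x1 + c2 * x2) = 0"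
  by (simp add: algebra_simps)

text \<open>For fixed \<open>\<sigma>\<close> the six terms share the factors outside
  \<open>i\<close>, \<open>j\<close>, \<open>k\<close>. What remains is the determinant of three
  rows and three columns of \<open>M\<close>, which vanishes because \<open>M\<close> has rank at
  most two.\<close>

lemma perm_products_two_row:
  fixes u1 u2 v1 v2 :: "'a::finite \<Rightarrow> real"
  assumes "\<And>i j. M i j = u1 i * v1 j + u2 i * v2 j"
  shows "perm_products M \<in> two_row"
  unfolding two_row_def vec_eq_iff
proof (intro CollectI allI impI)
  let ?t = Transposition.transpose and ?w = "perm_products M"
  fix i j k :: 'a and \<sigma> :: "'a \<Rightarrow> 'a" assume ijk: "i \<noteq> j" "j \<noteq> k" "i \<noteq> k"
  have t: "?t a b permutes UNIV" for a b :: 'a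
    by (intro permutes_swap_id) auto
  let ?q = "\<lambda>\<rho>. M i (\<sigma> (\<rho> i)) * M j (\<sigma> (\<rho> j)) * M k (\<sigma> (\<rho> k))"
  have val: "right_translate \<rho> ?w $ \<sigma> = (if \<sigma> permutes UNIV then ?q \<rho> * (\<Prod>l\<in>UNIV - {i, j, k}. M l (\<sigma> l)) else 0)"
    if "\<rho> permutes UNIV" "\<And>l. l \<notin> {i, j, k} \<Longrightarrow> \<rho> l = l" for \<rho>
  proof -
    have "(\<Prod>l\<in>UNIV. M l (\<sigma> (\<rho> l))) = (\<Prod>l\<in>{i, j, k}. M l (\<sigma> (\<rho> l))) * (\<Prod>l\<in>UNIV - {i, j, k}. M l (\<sigma> (\<rho> l)))"
      by (metis (no_types, lifting) finite mult.commute prod.subset_diff subset_UNIV)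
    also have "(\<Prod>l\<in>UNIV - {i, j, k}. M l (\<sigma> (\<rho> l))) = (\<Prod>l\<in>UNIV - {i, j, k}. M l (\<sigma> l))"
      using that(2) by (intro prod.cong) auto
    finally show ?thesis
      using ijk that(1) by (simp add: right_translate_def perm_products_def permutes_UNIV_comp_iff)
  qed
  have "right_translate id ?w $ \<sigma> - right_translate (?t i j) ?w $ \<sigma> - right_translate (?t i k) ?w $ \<sigma>
      - right_translate (?t j k) ?w $ \<sigma> + right_translate (?t i k \<circ> ?t j k) ?w $ \<sigma>
      + right_translate (?t j k \<circ> ?t i k) ?w $ \<sigma> = 0"
  proof (cases "\<sigma> permutes UNIV")
    case True
    have "?q id - ?q (?t i j) - ?q (?t i k) - ?q (?t j k) + ?q (?t i k \<circ> ?t j k) + ?q (?t j k \<circ> ?t i k) = 0"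
      using ijk by (simp add: Transposition.transpose_def assms rank_two_antisymmetrised)
    then have "(?q id - ?q (?t i j) - ?q (?t i k) - ?q (?t j k) + ?q (?t i k \<circ> ?t j k) + ?q (?t j k \<circ> ?t i k))
       * (\<Prod>l\<in>UNIV - {i, j, k}. M l (\<sigma> l)) = 0"
      by simp
    moreover have "right_translate \<rho> ?w $ \<sigma> = ?q \<rho> * (\<Prod>l\<in>UNIV - {i, j, k}. M l (\<sigma> l))"
      if "\<rho> \<in> {id, ?t i j, ?t i k, ?t j k, ?t i k \<circ> ?t j k, ?t j k \<circ> ?t i k}" for \<rho>
    proof -
      have "\<rho> permutes UNIV"
        using that t by (auto intro: permutes_compose permutes_id)
      moreover have "\<rho> l = l" if "l \<notin> {i, j, k}" for l
        using that \<open>\<rho> \<in> _\<close> by auto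
      ultimately show ?thesis
        using val True by simp
    qed
    ultimately show ?thesis
      by (simp add: distrib_right left_diff_distrib del: right_translate_id)
  next
    case False
    then show ?thesis
      by (simp add: right_translate_def perm_products_def permutes_UNIV_comp_iff t permutes_compose)
  qed
  then show "(?w - right_translate (?t i j) ?w - right_translate (?t i k) ?w - right_translate (?t j k) ?w
      + right_translate (?t i k \<circ> ?t j k) ?w + right_translate (?t j k \<circ> ?t i k) ?w) $ \<sigma> = 0 $ \<sigma>"
    by simp
qed

lemma inner_right_translate_perm_products:
  assumes "\<rho> permutes UNIV"
  shows "perm_products M \<bullet> right_translate \<rho> (perm_products M)
    = (\<Sum>\<sigma> | \<sigma> permutes UNIV. (\<Prod>i\<in>UNIV. M i (\<sigma> i)) * (\<Prod>i\<in>UNIV. M i (\<sigma> (\<rho> i))))"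
proof -
  have "perm_products M \<bullet> right_translate \<rho> (perm_products M) = (\<Sum>\<sigma>\<in>UNIV. if \<sigma> permutes UNIV
      then (\<Prod>i\<in>UNIV. M i (\<sigma> i)) * (\<Prod>i\<in>UNIV. M i (\<sigma> (\<rho> i))) else 0)"
    by (auto simp: inner_vec_def perm_products_def right_translate_def permutes_UNIV_comp_iff assms intro!: sum.cong)
  then show ?thesis
    by (simp add: sum.inter_filter[symmetric])
qed

text \<open>For fixed \<open>\<sigma>\<close> the composite \<open>\<sigma> \<circ> \<rho>\<close>
  runs over all permutations, so the double sum factors.\<close>

lemma sym_sum_perm_products:
  "perm_products M \<bullet> sym_sum UNIV (perm_products M) = (permanent UNIV M)\<^sup>2"
proof -
  let ?h = "\<lambda>\<sigma>. \<Prod>i\<in>UNIV. M i (\<sigma> i)"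
  have "perm_products M \<bullet> sym_sum UNIV (perm_products M)
      = (\<Sum>\<rho> | \<rho> permutes UNIV. \<Sum>\<sigma> | \<sigma> permutes UNIV. ?h \<sigma> * ?h (\<sigma> \<circ> \<rho>))"
    by (simp add: sym_sum_def inner_sum_right inner_right_translate_perm_products)
  also have "\<dots> = (\<Sum>\<sigma> | \<sigma> permutes UNIV. \<Sum>\<rho> | \<rho> permutes UNIV. ?h \<sigma> * ?h (\<sigma> \<circ> \<rho>))"
    by (rule sum.swap)
  also have "\<dots> = (\<Sum>\<sigma> | \<sigma> permutes UNIV. \<Sum>\<rho> | \<rho> permutes UNIV. ?h \<sigma> * ?h \<rho>)"
    by (intro sum.cong refl setum_permutations_compose_left[symmetric]) simp
  also have "\<dots> = (permanent UNIV M)\<^sup>2"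
    by (simp add: permanent_def power2_eq_square sum_product)
  finally show ?thesis .
qed

section \<open>Permanents of doubled matrices\<close>

text \<open>
  A permutation of \<open>'a \<times> bool\<close> is obtained from two permutations of \<open>'a\<close>, one for each value of the
  second component, by exchanging the two copies of the points of \<open>E\<close> in the domain and of \<open>D\<close> in
  the range. The fibre of this map through \<open>(\<sigma>, \<tau>, D, E)\<close> corresponds to the invariant sets of
  \<open>inv \<sigma> \<circ> \<tau>\<close>, and the map is onto because the weighted count of its domain is already \<open>(2 * n)!\<close>.
\<close>

definition double_perm ::
  "('a \<Rightarrow> 'a) \<times> ('a \<Rightarrow> 'a) \<times> 'a set \<times> 'a set \<Rightarrow> 'a \<times> bool \<Rightarrow> 'a \<times> bool" where
  "double_perm = (\<lambda>(\<sigma>, \<tau>, D, E) (i, b).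
     let c = (b \<noteq> (i \<in> E)); j = (if c then \<tau> i else \<sigma> i) in (j, c \<noteq> (j \<in> D)))"

definition double_dom :: "(('a::finite \<Rightarrow> 'a) \<times> ('a \<Rightarrow> 'a) \<times> 'a set \<times> 'a set) set" where
  "double_dom = {\<sigma>. \<sigma> permutes UNIV} \<times> {\<tau>. \<tau> permutes UNIV} \<times> UNIV \<times> UNIV"

lemma inj_permutes_UNIV:
  fixes f :: "'a::finite \<Rightarrow> 'a"
  shows "inj f \<Longrightarrow> f permutes UNIV"
  by (intro bij_imp_permutes) (auto simp: bij_def finite_UNIV_inj_surj)

lemma double_perm_permutes:
  assumes "x \<in> double_dom"
  shows "double_perm x permutes UNIV"
proof -
  obtain \<sigma> \<tau> D E where x: "x = (\<sigma>, \<tau>, D, E)" by (cases x)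
  have "inj \<sigma>" "inj \<tau>"
    using assms by (auto simp: x double_dom_def permutes_inj)
  have "inj (double_perm x)"
  proof (rule injI)
    fix p q assume eq: "double_perm x p = double_perm x q"
    obtain i b i' b' where pq: "p = (i, b)" "q = (i', b')" by (cases p; cases q)
    define c c' where "c \<longleftrightarrow> b \<noteq> (i \<in> E)" and "c' \<longleftrightarrow> b' \<noteq> (i' \<in> E)"
    have eq': "(if c then \<tau> i else \<sigma> i) = (if c' then \<tau> i' else \<sigma> i') \<and>
        (c \<noteq> ((if c then \<tau> i else \<sigma> i) \<in> D)) = (c' \<noteq> ((if c' then \<tau> i' else \<sigma> i') \<in> D))"
      using eq unfolding pq x double_perm_def Let_def c_def c'_def split_conv prod.inject .
    note j = conjunct1[OF eq']
    have c: "c = c'"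
      using conjunct2[OF eq'] unfolding j by blast
    have "i = i'"
      using j \<open>inj \<sigma>\<close> \<open>inj \<tau>\<close> unfolding c by (cases c') (auto dest: injD)
    then show "p = q"
      using c by (auto simp: pq c_def c'_def)
  qed
  then show ?thesis by (rule inj_permutes_UNIV)
qed

text \<open>Two preimages differ by interchanging \<open>\<sigma>0\<close> and
  \<open>\<tau>0\<close> on a set \<open>S\<close> and toggling the labels accordingly. The
  interchanged maps are permutations iff \<open>\<sigma>0\<close> and \<open>\<tau>0\<close> have
  the same image of \<open>S\<close>, that is, iff \<open>S\<close> is invariant under
  \<open>inv \<sigma>0 \<circ> \<tau>0\<close>.\<close>

lemma card_double_perm_fibre:
  assumes "x0 \<in> double_dom" and x0: "x0 = (\<sigma>0, \<tau>0, D0, E0)"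
  shows "card {x \<in> double_dom. double_perm x = double_perm x0} = card (invariant_sets UNIV (inv \<sigma>0 \<circ> \<tau>0))"
proof -
  have perm: "\<sigma>0 permutes UNIV" "\<tau>0 permutes UNIV"
    using assms by (auto simp: double_dom_def)
  have inv: "inv \<sigma>0 (\<sigma>0 i) = i" "\<sigma>0 (inv \<sigma>0 i) = i" for i
    using perm permutes_inverses by metis+
  have inj: "\<sigma>0 i = \<sigma>0 j \<longleftrightarrow> i = j" "\<tau>0 i = \<tau>0 j \<longleftrightarrow> i = j" for i j
    using perm by (metis permutes_inverses(2))+
  define f where "f S = (\<lambda>i. if i \<in> S then \<tau>0 i else \<sigma>0 i, \<lambda>i. if i \<in> S then \<sigma>0 i else \<tau>0 i,
      {j. (j \<in> D0) \<noteq> (inv \<sigma>0 j \<in> S)}, {i. (i \<in> E0) \<noteq> (i \<in> S)})" for S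
  define g where "g x = {i. (i \<in> snd (snd (snd x))) \<noteq> (i \<in> E0)}" for x :: "('a \<Rightarrow> 'a) \<times> ('a \<Rightarrow> 'a) \<times> 'a set \<times> 'a set"
  have "bij_betw f (invariant_sets UNIV (inv \<sigma>0 \<circ> \<tau>0)) {x \<in> double_dom. double_perm x = double_perm x0}"
  proof (rule bij_betw_byWitness[where f' = g])
    show "\<forall>S\<in>invariant_sets UNIV (inv \<sigma>0 \<circ> \<tau>0). g (f S) = S"
      by (auto simp: f_def g_def)
    show "f ` invariant_sets UNIV (inv \<sigma>0 \<circ> \<tau>0) \<subseteq> {x \<in> double_dom. double_perm x = double_perm x0}"
    proof (intro image_subsetI CollectI conjI)
      fix S assume "S \<in> invariant_sets UNIV (inv \<sigma>0 \<circ> \<tau>0)"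
      then have S: "inv \<sigma>0 (\<tau>0 i) \<in> S \<longleftrightarrow> i \<in> S" for i
        by (auto simp: invariant_sets_def)
      have ne: "\<tau>0 i \<noteq> \<sigma>0 j" if "i \<in> S \<longleftrightarrow> j \<notin> S" for i j
        using S[of i] inv(1)[of j] that by metis
      have "inj (\<lambda>i. if i \<in> S then \<tau>0 i else \<sigma>0 i)" "inj (\<lambda>i. if i \<in> S then \<sigma>0 i else \<tau>0 i)"
        using ne by (auto simp: inj_def inj) metis+
      then show "f S \<in> double_dom"
        by (auto simp: f_def double_dom_def intro!: inj_permutes_UNIV)
      show "double_perm (f S) = double_perm x0"
        using S by (auto simp: fun_eq_iff f_def x0 double_perm_def Let_def inv)
    qed
    have main: "g x \<in> invariant_sets UNIV (inv \<sigma>0 \<circ> \<tau>0) \<and> f (g x) = x"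
      if x: "x \<in> double_dom" "double_perm x = double_perm x0" for x
    proof -
      obtain \<sigma> \<tau> D E where xe: "x = (\<sigma>, \<tau>, D, E)" by (cases x)
      define S where "S = g x"
      have S: "i \<in> S \<longleftrightarrow> (i \<in> E) \<noteq> (i \<in> E0)" for i
        by (simp add: S_def g_def xe)
      have eq: "double_perm x (i, c \<noteq> (i \<in> E0)) = double_perm x0 (i, c \<noteq> (i \<in> E0))" for i c
        by (simp add: x(2))
      \<comment> \<open>Both permutations are compared at the copy of \<open>i\<close> that
        \<open>x0\<close> sends through \<open>\<tau>0\<close>, and for \<open>F\<close> at the copy
        sent through \<open>\<sigma>0\<close>.\<close>
      have T: "(if i \<in> S then \<sigma> i else \<tau> i) = \<tau>0 i" "(i \<in> S) \<noteq> (\<tau>0 i \<in> D) \<longleftrightarrow> \<tau>0 i \<in> D0" for i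
        using eq[of i True] S[of i] by (auto simp: xe x0 double_perm_def Let_def split: if_splits)
      have F: "(if i \<in> S then \<tau> i else \<sigma> i) = \<sigma>0 i" "(i \<in> S) \<noteq> (\<sigma>0 i \<in> D) \<longleftrightarrow> \<sigma>0 i \<in> D0" for i
        using eq[of i False] S[of i] by (auto simp: xe x0 double_perm_def Let_def split: if_splits)
      have D: "j \<in> D \<longleftrightarrow> (j \<in> D0) \<noteq> (inv \<sigma>0 j \<in> S)" for j
        using F(2)[of "inv \<sigma>0 j"] by (auto simp: inv)
      have "inv \<sigma>0 (\<tau>0 i) \<in> S \<longleftrightarrow> i \<in> S" for i
        using D[of "\<tau>0 i"] T(2)[of i] by auto
      then have "S \<in> invariant_sets UNIV (inv \<sigma>0 \<circ> \<tau>0)"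
        by (auto simp: invariant_sets_def)
      moreover have "f S = x"
      proof -
        have "(if i \<in> S then \<tau>0 i else \<sigma>0 i) = \<sigma> i" "(if i \<in> S then \<sigma>0 i else \<tau>0 i) = \<tau> i" for i
          using T(1)[of i] F(1)[of i] by (cases "i \<in> S"; simp)+
        moreover have "{i. (i \<in> E0) \<noteq> (i \<in> S)} = E"
          using S by auto
        moreover have "{j. (j \<in> D0) \<noteq> (inv \<sigma>0 j \<in> S)} = D"
          using D by auto
        ultimately show ?thesis
          by (simp add: f_def xe)
      qed
      ultimately show ?thesis by (simp add: S_def)
    qed
    then show "\<forall>x\<in>{x \<in> double_dom. double_perm x = double_perm x0}. f (g x) = x"
      by blast
    show "g ` {x \<in> double_dom. double_perm x = double_perm x0} \<subseteq> invariant_sets UNIV (inv \<sigma>0 \<circ> \<tau>0)"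
      using main by blast
  qed
  then show ?thesis
    by (simp add: bij_betw_same_card)
qed

text \<open>The reciprocal of the size of the fibre of \<open>double_perm\<close>, so that each
  fibre has total weight 1.\<close>

definition double_weight :: "('a::finite \<Rightarrow> 'a) \<times> ('a \<Rightarrow> 'a) \<times> 'a set \<times> 'a set \<Rightarrow> real" where
  "double_weight = (\<lambda>(\<sigma>, \<tau>, D, E). inverse (real (card (invariant_sets UNIV (inv \<sigma> \<circ> \<tau>)))))"

text \<open>The summand ignores \<open>D\<close> and \<open>E\<close>, whence the power of 4; then
  \<open>\<tau> = \<sigma> \<circ> \<rho>\<close> is substituted.\<close>

lemma sum_double_dom:
  "(\<Sum>x\<in>double_dom. double_weight x * h (fst x) (fst (snd x))) =
    4 ^ CARD('a::finite) * (\<Sum>\<sigma>\<in>{\<sigma> :: 'a \<Rightarrow> 'a. \<sigma> permutes UNIV}. \<Sum>\<rho> | \<rho> permutes UNIV.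
       inverse (real (card (invariant_sets UNIV \<rho>))) * h \<sigma> (\<sigma> \<circ> \<rho>))"
proof -
  have "(\<Sum>x\<in>double_dom. double_weight x * h (fst x) (fst (snd x)))
      = (\<Sum>\<sigma>\<in>{\<sigma> :: 'a \<Rightarrow> 'a. \<sigma> permutes UNIV}. \<Sum>\<tau> | \<tau> permutes UNIV. \<Sum>D\<in>(UNIV :: 'a set set). \<Sum>E\<in>(UNIV :: 'a set set).
         inverse (real (card (invariant_sets UNIV (inv \<sigma> \<circ> \<tau>)))) * h \<sigma> \<tau>)"
    by (simp add: double_dom_def double_weight_def sum.cartesian_product split_def
        del: sum_constant UNIV_Times_UNIV)
  also have "\<dots> = 4 ^ CARD('a) * (\<Sum>\<sigma>\<in>{\<sigma> :: 'a \<Rightarrow> 'a. \<sigma> permutes UNIV}. \<Sum>\<tau> | \<tau> permutes UNIV.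
         inverse (real (card (invariant_sets UNIV (inv \<sigma> \<circ> \<tau>)))) * h \<sigma> \<tau>)"
  proof -
    have "(4::real) ^ n = 2 ^ n * 2 ^ n" for n
      by (simp flip: power_mult_distrib)
    then show ?thesis by (simp add: card_UNIV_set sum_distrib_left mult.assoc)
  qed
  also have "(\<Sum>\<sigma>\<in>{\<sigma> :: 'a \<Rightarrow> 'a. \<sigma> permutes UNIV}. \<Sum>\<tau> | \<tau> permutes UNIV.
         inverse (real (card (invariant_sets UNIV (inv \<sigma> \<circ> \<tau>)))) * h \<sigma> \<tau>)
      = (\<Sum>\<sigma>\<in>{\<sigma> :: 'a \<Rightarrow> 'a. \<sigma> permutes UNIV}. \<Sum>\<rho> | \<rho> permutes UNIV.
         inverse (real (card (invariant_sets UNIV (inv \<sigma> \<circ> (\<sigma> \<circ> \<rho>))))) * h \<sigma> (\<sigma> \<circ> \<rho>))"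
    by (intro sum.cong refl setum_permutations_compose_left) simp
  also have "\<dots> = (\<Sum>\<sigma>\<in>{\<sigma> :: 'a \<Rightarrow> 'a. \<sigma> permutes UNIV}. \<Sum>\<rho> | \<rho> permutes UNIV.
       inverse (real (card (invariant_sets UNIV \<rho>))) * h \<sigma> (\<sigma> \<circ> \<rho>))"
    by (intro sum.cong refl) (simp add: comp_assoc[symmetric] permutes_inv_o)
  finally show ?thesis .
qed

lemma sum_double_image:
  "(\<Sum>x\<in>double_dom. double_weight x * h (double_perm x)) = (\<Sum>\<pi>\<in>double_perm ` double_dom. h \<pi> :: real)"
proof -
  have fin: "finite (double_dom :: (('a::finite \<Rightarrow> 'a) \<times> _) set)"
    by (rule finite)
  have "(\<Sum>x\<in>double_dom. double_weight x * h (double_perm x))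
      = (\<Sum>\<pi>\<in>double_perm ` double_dom. \<Sum>x\<in>{x \<in> double_dom. double_perm x = \<pi>}. double_weight x * h (double_perm x))"
    by (rule sum.image_gen[OF fin])
  also have "\<dots> = (\<Sum>\<pi>\<in>double_perm ` double_dom. h \<pi>)"
  proof (intro sum.cong refl)
    fix \<pi> assume \<pi>: "\<pi> \<in> double_perm ` (double_dom :: (('a::finite \<Rightarrow> 'a) \<times> _) set)"
    let ?F = "{x \<in> double_dom. double_perm x = \<pi>}"
    have "double_weight x = inverse (real (card ?F))" if "x \<in> ?F" for x
    proof -
      obtain \<sigma> \<tau> D E where x: "x = (\<sigma>, \<tau>, D, E)" by (cases x)
      show ?thesis
        using card_double_perm_fibre[OF _ x] that by (auto simp: double_weight_def x)
    qed
    then have "(\<Sum>x\<in>?F. double_weight x * h (double_perm x)) = (\<Sum>x\<in>?F. inverse (real (card ?F)) * h \<pi>)"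
      by (intro sum.cong) auto
    moreover have "card ?F \<noteq> 0"
      using \<pi> by (auto simp: card_eq_0_iff)
    ultimately show "(\<Sum>x\<in>?F. double_weight x * h (double_perm x)) = h \<pi>"
      by simp
  qed
  finally show ?thesis .
qed

lemma double_perm_image:
  "double_perm ` double_dom = {\<pi>. \<pi> permutes (UNIV :: ('a::finite \<times> bool) set)}"
proof (rule card_subset_eq)
  show "double_perm ` double_dom \<subseteq> {\<pi>. \<pi> permutes (UNIV :: ('a \<times> bool) set)}"
    using double_perm_permutes by blast
  have "real (card (double_perm ` (double_dom :: (('a \<Rightarrow> 'a) \<times> _) set)))
      = (\<Sum>x\<in>(double_dom :: (('a \<Rightarrow> 'a) \<times> _) set). double_weight x * 1)"
    by (subst sum_double_image) simp
  also have "\<dots> = 4 ^ CARD('a) * (\<Sum>\<sigma>\<in>{\<sigma> :: 'a \<Rightarrow> 'a. \<sigma> permutes UNIV}. cycle_weight (UNIV :: 'a set))"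
    by (subst sum_double_dom) (simp add: cycle_weight_def)
  also have "\<dots> = cycle_weight (UNIV :: 'a set) * (4 ^ CARD('a) * fact CARD('a))"
    by (simp add: card_permutations)
  also have "\<dots> = fact (2 * CARD('a))"
    by (rule cycle_weight_eq)
  also have "fact (2 * CARD('a)) = real (card {\<pi>. \<pi> permutes (UNIV :: ('a \<times> bool) set)})"
    by (subst card_permutations[OF refl]) (simp_all add: mult.commute)
  finally show "card (double_perm ` (double_dom :: (('a \<Rightarrow> 'a) \<times> _) set))
      = card {\<pi>. \<pi> permutes (UNIV :: ('a \<times> bool) set)}"
    by simp
qed auto

text \<open>Exchanging copies does not change the entries of \<open>M\<close>, so each product
  splits into one along \<open>\<sigma>\<close> and one along \<open>\<tau>\<close>.\<close>

lemma permanent_double: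
  "(\<Sum>\<pi> | \<pi> permutes (UNIV :: ('a::finite \<times> bool) set). \<Prod>p\<in>UNIV. M (fst p) (fst (\<pi> p)) :: real) =
    4 ^ CARD('a) * (\<Sum>\<sigma>\<in>{\<sigma> :: 'a \<Rightarrow> 'a. \<sigma> permutes UNIV}. \<Sum>\<rho> | \<rho> permutes UNIV.
       inverse (real (card (invariant_sets UNIV \<rho>))) * ((\<Prod>i\<in>UNIV. M i (\<sigma> i)) * (\<Prod>i\<in>UNIV. M i (\<sigma> (\<rho> i)))))"
proof -
  have prod: "(\<Prod>p\<in>UNIV. M (fst p) (fst (double_perm x p)))
      = (\<Prod>i\<in>UNIV. M i (fst x i)) * (\<Prod>i\<in>UNIV. M i (fst (snd x) i))" for x
  proof -
    obtain \<sigma> \<tau> D E where x: "x = (\<sigma>, \<tau>, D, E)" by (cases x)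
    have "(\<Prod>p\<in>UNIV. M (fst p) (fst (double_perm x p)))
        = (\<Prod>i\<in>UNIV. \<Prod>b\<in>UNIV. M i (fst (double_perm x (i, b))))"
      by (simp add: prod.cartesian_product split_def)
    also have "\<dots> = (\<Prod>i\<in>UNIV. M i (\<sigma> i) * M i (\<tau> i))"
      by (intro prod.cong refl) (simp add: UNIV_bool double_perm_def x Let_def)
    finally show ?thesis by (simp add: prod.distrib x)
  qed
  show ?thesis
    using sum_double_dom[of "\<lambda>\<sigma> \<tau>. (\<Prod>i\<in>UNIV. M i (\<sigma> i)) * (\<Prod>i\<in>UNIV. M i (\<tau> i))"]
    by (simp add: double_perm_image[symmetric] sum_double_image[symmetric] prod)
qed

section \<open>Permanents of rank two matrices\<close>

text \<open>The coefficient of \<open>t^k\<close> in the product of the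
  \<open>g i + f i * t\<close>. Values in a semiring are allowed because polynomial-valued
  \<open>f\<close> and \<open>g\<close> occur too.\<close>

definition esum :: "'a set \<Rightarrow> ('a \<Rightarrow> 'b::comm_semiring_1) \<Rightarrow> ('a \<Rightarrow> 'b) \<Rightarrow> nat \<Rightarrow> 'b" where
  "esum I f g k = (\<Sum>T | T \<subseteq> I \<and> card T = k. prod f T * prod g (I - T))"

lemma sum_Pow_card:
  fixes F :: "'a set \<Rightarrow> 'b::comm_monoid_add"
  assumes "finite I"
  shows "(\<Sum>T\<in>Pow I. F T) = (\<Sum>k\<le>card I. \<Sum>T | T \<subseteq> I \<and> card T = k. F T)"
proof -
  have "(\<Sum>k\<le>card I. \<Sum>T\<in>{T \<in> Pow I. card T = k}. F T) = (\<Sum>T\<in>Pow I. F T)"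
    using assms by (intro sum.group) (auto simp: card_mono)
  then show ?thesis by (simp add: Pow_def)
qed

lemma prod_add_esum:
  fixes f g :: "'a \<Rightarrow> 'b::comm_semiring_1"
  assumes "finite I"
  shows "(\<Prod>i\<in>I. f i + g i) = (\<Sum>k\<le>card I. esum I f g k)"
  by (simp only: prod_add[OF assms] sum_Pow_card[OF assms] esum_def)

lemma esum_eq_0: "finite I \<Longrightarrow> k > card I \<Longrightarrow> esum I f g k = 0"
  unfolding esum_def by (metis (mono_tags, lifting) card_mono leD mem_Collect_eq sum.neutral)

lemma esum_scale: "esum I (\<lambda>i. c * f i) g k = c ^ k * esum I f g k"
  unfolding esum_def sum_distrib_left
  by (intro sum.cong) (auto simp: prod.distrib mult_ac)

lemma esum_commute:
  assumes "finite I" "k \<le> card I"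
  shows "esum I f g k = esum I g f (card I - k)"
  unfolding esum_def
  by (rule sum.reindex_bij_witness[where i = "\<lambda>T. I - T" and j = "\<lambda>T. I - T"])
    (use assms in \<open>auto simp: double_diff card_Diff_subset finite_subset mult.commute\<close>)

lemma coeff_prod_esum:
  fixes f g :: "'a \<Rightarrow> 'b::comm_semiring_1"
  assumes "finite I"
  shows "coeff (\<Prod>i\<in>I. [:g i, f i:]) k = esum I f g k"
proof -
  have m: "(\<Prod>i\<in>T. monom (f i) 1) = monom (prod f T) (card T)" for T
    by (induction T rule: infinite_finite_induct) (auto simp: mult_monom)
  have c: "(\<Prod>i\<in>T. [:g i:]) = [:prod g T:]" for T
    by (induction T rule: infinite_finite_induct) (auto simp: one_pCons mult_ac)
  have e: "esum I (\<lambda>i. monom (f i) 1) (\<lambda>i. [:g i:]) l = monom (esum I f g l) l" for l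
    unfolding esum_def monom_sum by (intro sum.cong refl) (auto simp: m[simplified] c smult_monom mult_ac)
  have "(\<Prod>i\<in>I. [:g i, f i:]) = (\<Prod>i\<in>I. monom (f i) 1 + [:g i:])"
    by (simp add: monom_altdef)
  also have "\<dots> = (\<Sum>l\<le>card I. monom (esum I f g l) l)"
    by (simp only: prod_add_esum[OF assms] e)
  finally show ?thesis
    using assms by (auto simp: coeff_sum esum_eq_0 not_le sum.delta)
qed

lemma obtain_permutation_image:
  assumes "finite I" "T \<subseteq> I" "T' \<subseteq> I" "card T = card T'"
  obtains \<rho> where "\<rho> permutes I" "\<rho> ` T = T'"
proof -
  have fin: "finite T" "finite T'"
    using assms finite_subset by blast+
  obtain f where f: "bij_betw f T T'"
    using assms(4) fin finite_same_card_bij by blast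
  have "card (I - T) = card (I - T')"
    using assms fin by (simp add: card_Diff_subset)
  then obtain g where g: "bij_betw g (I - T) (I - T')"
    using assms(1) by (meson finite_Diff finite_same_card_bij)
  define \<rho> where "\<rho> x = (if x \<in> T then f x else if x \<in> I then g x else x)" for x
  have 1: "bij_betw \<rho> T T'"
    using f by (subst bij_betw_cong[of T \<rho> f]) (simp_all add: \<rho>_def)
  have 2: "bij_betw \<rho> (I - T) (I - T')"
    using g by (subst bij_betw_cong[of "I - T" \<rho> g]) (simp_all add: \<rho>_def)
  have "bij_betw \<rho> (T \<union> (I - T)) (T' \<union> (I - T'))"
    using 1 2 by (rule bij_betw_combine) auto
  then have "bij_betw \<rho> I I"
    using assms by (simp add: Un_absorb1)
  then have "\<rho> permutes I"
    using assms by (intro bij_imp_permutes) (auto simp: \<rho>_def)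
  then show ?thesis
    using that 1 by (simp add: bij_betw_def)
qed

text \<open>The sum over permutations depends on \<open>T\<close> only through its cardinality, so it may be
  averaged over all \<open>T\<close> of that cardinality.\<close>

lemma sum_permutations_image:
  fixes h :: "'a set \<Rightarrow> real"
  assumes "finite I" "T \<subseteq> I"
  shows "(\<Sum>\<pi> | \<pi> permutes I. h (\<pi> ` T)) =
    fact (card T) * fact (card I - card T) * (\<Sum>S | S \<subseteq> I \<and> card S = card T. h S)"
proof -
  let ?C = "{S. S \<subseteq> I \<and> card S = card T}" and ?P = "{\<pi>. \<pi> permutes I}"
  have le: "card T \<le> card I"
    using assms by (rule card_mono)
  have const: "(\<Sum>\<pi>\<in>?P. h (\<pi> ` S)) = (\<Sum>\<pi>\<in>?P. h (\<pi> ` T))" if "S \<in> ?C" for S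
  proof -
    obtain \<rho> where \<rho>: "\<rho> permutes I" "\<rho> ` T = S"
      using obtain_permutation_image[OF assms(1,2), of S] \<open>S \<in> ?C\<close> by auto
    have "(\<Sum>\<pi>\<in>?P. h (\<pi> ` T)) = (\<Sum>\<pi>\<in>?P. h ((\<pi> \<circ> \<rho>) ` T))"
      using \<rho>(1) by (rule sum_permutations_compose_right)
    then show ?thesis
      by (simp only: image_comp[symmetric] \<rho>(2))
  qed
  have img: "(\<Sum>S\<in>?C. h (\<pi> ` S)) = (\<Sum>S\<in>?C. h S)" if "\<pi> \<in> ?P" for \<pi>
  proof (rule sum.reindex_bij_witness[where i = "\<lambda>S. inv \<pi> ` S" and j = "\<lambda>S. \<pi> ` S"])
    have \<pi>: "\<pi> permutes I" using that by simp
    have "inj \<pi>" "inj (inv \<pi>)"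
      using \<pi> permutes_inv[OF \<pi>] by (simp_all add: permutes_inj)
    then have card: "card (\<pi> ` S) = card S" "card (inv \<pi> ` S) = card S" for S
      by (meson card_image inj_on_subset subset_UNIV)+
    show "\<pi> ` S \<in> ?C" "inv \<pi> ` S \<in> ?C" if "S \<in> ?C" for S
      using that image_mono[of S I \<pi>] image_mono[of S I "inv \<pi>"]
      by (simp_all add: card permutes_image[OF \<pi>] permutes_image[OF permutes_inv[OF \<pi>]])
    show "inv \<pi> ` \<pi> ` S = S" "\<pi> ` inv \<pi> ` S = S" for S
      by (simp_all add: image_comp permutes_inv_o[OF \<pi>])
  qed auto
  have "real (card I choose card T) * (\<Sum>\<pi>\<in>?P. h (\<pi> ` T)) = (\<Sum>S\<in>?C. \<Sum>\<pi>\<in>?P. h (\<pi> ` S))"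
    using assms(1) by (simp add: const n_subsets)
  also have "\<dots> = (\<Sum>\<pi>\<in>?P. \<Sum>S\<in>?C. h (\<pi> ` S))"
    by (rule sum.swap)
  also have "\<dots> = fact (card I) * (\<Sum>S\<in>?C. h S)"
    using assms(1) by (simp add: img card_permutations)
  finally show ?thesis
    using le by (simp add: binomial_fact field_simps)
qed

text \<open>Expanding the product chooses the set \<open>T\<close> of rows that use the first
  summand. The columns then enter only through the image of \<open>T\<close>, over which the
  permutations average.\<close>

lemma permanent_rank_two:
  assumes "finite I"
  shows "permanent I (\<lambda>i j. u1 i * v1 j + u2 i * v2 j) =
    (\<Sum>k\<le>card I. fact k * fact (card I - k) * esum I u1 u2 k * esum I v1 v2 k)"
proof -
  let ?U = "\<lambda>T. prod u1 T * prod u2 (I - T)" and ?V = "\<lambda>T. prod v1 T * prod v2 (I - T)"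
  have "(\<Prod>i\<in>I. u1 i * v1 (\<pi> i) + u2 i * v2 (\<pi> i)) = (\<Sum>T\<in>Pow I. ?U T * ?V (\<pi> ` T))"
    if "\<pi> permutes I" for \<pi>
  proof -
    have inj: "inj_on \<pi> S" for S
      using that permutes_inj inj_on_subset by blast
    have "prod v2 (I - \<pi> ` T) = (\<Prod>i\<in>I - T. v2 (\<pi> i))" if "T \<subseteq> I" for T
    proof -
      have "I - \<pi> ` T = \<pi> ` (I - T)"
        using \<open>\<pi> permutes I\<close> by (simp add: image_set_diff permutes_inj permutes_image)
      then show ?thesis
        by (simp add: prod.reindex inj)
    qed
    then show ?thesis
      unfolding prod_add[OF assms] by (auto simp: prod.distrib prod.reindex inj intro!: sum.cong)
  qed
  then have "permanent I (\<lambda>i j. u1 i * v1 j + u2 i * v2 j) = (\<Sum>\<pi> | \<pi> permutes I. \<Sum>T\<in>Pow I. ?U T * ?V (\<pi> ` T))"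
    by (simp add: permanent_def)
  also have "\<dots> = (\<Sum>T\<in>Pow I. ?U T * (\<Sum>\<pi> | \<pi> permutes I. ?V (\<pi> ` T)))"
    by (subst sum.swap) (simp add: sum_distrib_left)
  also have "\<dots> = (\<Sum>T\<in>Pow I. ?U T * (fact (card T) * fact (card I - card T) * esum I v1 v2 (card T)))"
    using assms by (intro sum.cong refl) (simp add: sum_permutations_image[where h = ?V] esum_def)
  also have "\<dots> = (\<Sum>k\<le>card I. \<Sum>T | T \<subseteq> I \<and> card T = k. ?U T * (fact k * fact (card I - k) * esum I v1 v2 k))"
    unfolding sum_Pow_card[OF assms] by (intro sum.cong refl) auto
  also have "\<dots> = (\<Sum>k\<le>card I. fact k * fact (card I - k) * esum I u1 u2 k * esum I v1 v2 k)"
    by (intro sum.cong refl) (simp add: esum_def[of I u1 u2] flip: sum_distrib_right)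
  finally show ?thesis .
qed

section \<open>Finite free convolutions\<close>

text \<open>Split the entry as \<open>x * 1 + (- a i) * b j\<close>. The permanent then pairs
  coefficients of equal index, and \<open>k! (n - k)!\<close> is \<open>n!\<close> over the binomial
  coefficient in the definition.\<close>

lemma poly_finite_free_mult:
  assumes "finite I"
  shows "permanent I (\<lambda>i j. x - a i * b j) =
    fact (card I) * poly (finite_free_mult (card I) (\<Prod>i\<in>I. [:- a i, 1:]) (\<Prod>i\<in>I. [:- b i, 1:])) x"
proof -
  define n where "n = card I"
  define p where "p = (\<Prod>i\<in>I. [:- a i, 1:])"
  define q where "q = (\<Prod>i\<in>I. [:- b i, 1:])"
  have p: "esum I (\<lambda>i. x) (\<lambda>i. - a i) k = x ^ k * coeff p k" for k
    unfolding p_def coeff_prod_esum[OF assms]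
    using esum_scale[of I x "\<lambda>i. 1" "\<lambda>i. - a i" k] by (simp only: mult_1_right)
  \<comment> \<open>\<open>esum_scale\<close> extracts a scalar from the first function only, hence
    the passage to complements and back to change the sign of \<open>b\<close>.\<close>
  have q: "esum I (\<lambda>i. 1) b k = (- 1) ^ (n - k) * coeff q k" if "k \<le> n" for k
  proof -
    have "esum I (\<lambda>i. 1) b k = esum I b (\<lambda>i. 1) (n - k)"
      unfolding n_def using that by (intro esum_commute assms) (simp add: n_def)
    also have "\<dots> = (- 1) ^ (n - k) * esum I (\<lambda>i. - b i) (\<lambda>i. 1) (n - k)"
      using esum_scale[of I "- 1" "\<lambda>i. - b i" "\<lambda>i. 1" "n - k"] by simp
    also have "esum I (\<lambda>i. - b i) (\<lambda>i. 1) (n - k) = esum I (\<lambda>i. 1) (\<lambda>i. - b i) k"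
      using that esum_commute[OF assms, of "n - k" "\<lambda>i. - b i" "\<lambda>i. 1"] by (simp add: n_def)
    finally show ?thesis
      unfolding q_def coeff_prod_esum[OF assms] .
  qed
  have "permanent I (\<lambda>i j. x - a i * b j) = permanent I (\<lambda>i j. x * 1 + (- a i) * b j)"
    by simp
  also have "\<dots> = (\<Sum>k\<le>n. fact k * fact (n - k) * (x ^ k * coeff p k) * ((- 1) ^ (n - k) * coeff q k))"
    by (subst permanent_rank_two[OF assms]) (simp add: p q n_def)
  also have "\<dots> = (\<Sum>i\<le>n. fact (n - i) * fact i * (x ^ (n - i) * coeff p (n - i)) * ((- 1) ^ i * coeff q (n - i)))"
    by (rule sum.reindex_bij_witness[where i = "\<lambda>i. n - i" and j = "\<lambda>i. n - i"]) auto
  also have "\<dots> = (\<Sum>i\<le>n. fact n * ((- 1) ^ i * (signed_coeff n p i * signed_coeff n q i / real (n choose i)) * x ^ (n - i)))"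
  proof (intro sum.cong refl)
    fix i assume "i \<in> {..n}"
    then have "fact n / real (n choose i) = fact i * fact (n - i)"
      by (simp add: binomial_fact)
    then have E: "fact n * ((- 1) ^ i * (s / real (n choose i)) * t) = fact i * fact (n - i) * ((- 1) ^ i * s * t)"
      for s t :: real
      by (metis (no_types, opaque_lifting) mult.assoc mult.left_commute times_divide_eq_left times_divide_eq_right)
    have "signed_coeff n p i * signed_coeff n q i = coeff p (n - i) * coeff q (n - i)"
      by (simp add: signed_coeff_def mult_ac)
    then show "fact (n - i) * fact i * (x ^ (n - i) * coeff p (n - i)) * ((- 1) ^ i * coeff q (n - i))
        = fact n * ((- 1) ^ i * (signed_coeff n p i * signed_coeff n q i / real (n choose i)) * x ^ (n - i))"
      by (simp only: E) (simp only: mult_ac)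
  qed
  also have "\<dots> = fact n * poly (finite_free_mult n p q) x"
    by (simp add: finite_free_mult_def poly_sum poly_monom sum_distrib_left)
  finally show ?thesis
    by (simp add: n_def p_def q_def)
qed

text \<open>Split the entry as \<open>(x - a i) * 1 + 1 * (- b j)\<close>. One factor gives the
  coefficients of \<open>q\<close>, the other the Taylor coefficients of \<open>p\<close> at
  \<open>x\<close>, whose binomials supply the remaining factorials.\<close>

lemma poly_finite_free_add:
  assumes "finite I"
  shows "permanent I (\<lambda>i j. x - a i - b j) =
    fact (card I) * poly (finite_free_add (card I) (\<Prod>i\<in>I. [:- a i, 1:]) (\<Prod>i\<in>I. [:- b i, 1:])) x"
proof -
  define n where "n = card I"
  define p where "p = (\<Prod>i\<in>I. [:- a i, 1:])"
  define q where "q = (\<Prod>i\<in>I. [:- b i, 1:])"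
  have q: "esum I (\<lambda>i. 1) (\<lambda>i. - b i) k = coeff q k" for k
    unfolding q_def coeff_prod_esum[OF assms] ..
  \<comment> \<open>This is the coefficient of \<open>t^(n - k)\<close> in \<open>p(t + x)\<close>,
    found by expanding in powers of \<open>t + x\<close>.\<close>
  have p: "esum I (\<lambda>i. x - a i) (\<lambda>i. 1) k = (\<Sum>l\<le>n. coeff p l * (real (l choose (n - k)) * x ^ (l - (n - k))))"
    if "k \<le> n" for k
  proof -
    have "esum I (\<lambda>i. x - a i) (\<lambda>i. 1) k = esum I (\<lambda>i. 1) (\<lambda>i. x - a i) (n - k)"
      unfolding n_def using that by (intro esum_commute assms) (simp add: n_def)
    also have "\<dots> = coeff (\<Prod>i\<in>I. [:x, 1:] + [:- a i:]) (n - k)"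
      by (simp flip: coeff_prod_esum[OF assms])
    also have "\<dots> = (\<Sum>l\<le>n. coeff (esum I (\<lambda>i. [:x, 1:]) (\<lambda>i. [:- a i:]) l) (n - k))"
      by (simp only: prod_add_esum[OF assms] coeff_sum n_def)
    also have "\<dots> = (\<Sum>l\<le>n. coeff p l * coeff ([:x, 1:] ^ l) (n - k))"
    proof (intro sum.cong refl)
      fix l
      have c: "(\<Prod>i\<in>T. [:- a i:]) = [:\<Prod>i\<in>T. - a i:]" for T
        by (induction T rule: infinite_finite_induct) (auto simp: one_pCons mult_ac)
      have "esum I (\<lambda>i. 1) (\<lambda>i. [:- a i:]) l = [:coeff p l:]"
        unfolding p_def coeff_prod_esum[OF assms] by (simp add: esum_def c sum_to_poly)
      then have "esum I (\<lambda>i. [:x, 1:]) (\<lambda>i. [:- a i:]) l = [:x, 1:] ^ l * [:coeff p l:]"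
        using esum_scale[of I "[:x, 1:]" "\<lambda>i. 1" "\<lambda>i. [:- a i:]" l] by simp
      then show "coeff (esum I (\<lambda>i. [:x, 1:]) (\<lambda>i. [:- a i:]) l) (n - k) = coeff p l * coeff ([:x, 1:] ^ l) (n - k)"
        by simp
    qed
    also have "\<dots> = (\<Sum>l\<le>n. coeff p l * (real (l choose (n - k)) * x ^ (l - (n - k))))"
    proof (intro sum.cong refl)
      fix l
      show "coeff p l * coeff ([:x, 1:] ^ l) (n - k) = coeff p l * (real (l choose (n - k)) * x ^ (l - (n - k)))"
      proof (cases "n - k \<le> l")
        case True
        then show ?thesis by (simp add: coeff_linear_poly_power)
      next
        case False
        moreover have "degree ([:x, 1:] ^ l) = l"
          by (simp add: degree_power_eq)
        ultimately show ?thesis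
          by (simp add: coeff_eq_0 binomial_eq_0)
      qed
    qed
    finally show ?thesis .
  qed
  define F where "F i j = fact (n - i) * fact (n - j) / fact (n - (i + j)) * coeff p (n - i) * coeff q (n - j) * x ^ (n - (i + j))" for i j
  have "permanent I (\<lambda>i j. x - a i - b j) = permanent I (\<lambda>i j. (x - a i) * 1 + 1 * (- b j))"
    by simp
  also have "\<dots> = (\<Sum>k\<le>n. fact k * fact (n - k) * (\<Sum>l\<le>n. coeff p l * (real (l choose (n - k)) * x ^ (l - (n - k)))) * coeff q k)"
    by (subst permanent_rank_two[OF assms]) (simp add: p q n_def[symmetric])
  also have "\<dots> = (\<Sum>j\<le>n. fact (n - j) * fact j * (\<Sum>l\<le>n. coeff p l * (real (l choose j) * x ^ (l - j))) * coeff q (n - j))"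
    by (rule sum.reindex_bij_witness[where i = "\<lambda>i. n - i" and j = "\<lambda>i. n - i"]) auto
  also have "\<dots> = (\<Sum>j\<le>n. fact (n - j) * fact j * (\<Sum>i\<le>n. coeff p (n - i) * (real ((n - i) choose j) * x ^ (n - i - j))) * coeff q (n - j))"
    by (intro sum.cong refl arg_cong2[where f = "(*)"]
        sum.reindex_bij_witness[where i = "\<lambda>i. n - i" and j = "\<lambda>i. n - i"]) auto
  \<comment> \<open>Terms with \<open>i + j > n\<close> vanish through the binomial. The case
    distinction is needed since \<open>F\<close> does not: there \<open>n - (i + j)\<close> is
    truncated to \<open>0\<close>.\<close>
  also have "\<dots> = (\<Sum>j\<le>n. \<Sum>i\<le>n. if i + j \<le> n then F i j else 0)"
    unfolding sum_distrib_left sum_distrib_right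
  proof (intro sum.cong refl)
    fix i j
    show "fact (n - j) * fact j * (coeff p (n - i) * (real ((n - i) choose j) * x ^ (n - i - j))) * coeff q (n - j)
        = (if i + j \<le> n then F i j else 0)" if "i \<in> {..n}" "j \<in> {..n}"
    proof (cases "i + j \<le> n")
      case True
      then have "real ((n - i) choose j) = fact (n - i) / (fact j * fact (n - (i + j)))"
        by (simp add: binomial_fact)
      then show ?thesis
        using True by (simp add: F_def)
    next
      case False
      then have "n - i < j" using that by auto
      then show ?thesis using False by (simp add: binomial_eq_0)
    qed
  qed
  also have "\<dots> = (\<Sum>(i, j)\<in>{..n} \<times> {..n}. if i + j \<le> n then F i j else 0)"
    by (subst sum.swap) (simp add: sum.cartesian_product)
  also have "\<dots> = (\<Sum>(i, j) | i + j \<le> n. F i j)"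
    by (rule sum.mono_neutral_cong_right) (auto split: if_splits)
  also have "\<dots> = (\<Sum>k\<le>n. \<Sum>i\<le>k. F i (k - i))"
    by (rule sum.triangle_reindex_eq)
  also have "\<dots> = (\<Sum>k\<le>n. \<Sum>(i, j) | i + j = k. F i j)"
  proof (intro sum.cong refl)
    fix k
    show "(\<Sum>i\<le>k. F i (k - i)) = (\<Sum>(i, j) | i + j = k. F i j)"
      by (rule sum.reindex_bij_witness[where i = fst and j = "\<lambda>i. (i, k - i)"]) auto
  qed
  also have "\<dots> = fact n * poly (finite_free_add n p q) x"
    unfolding finite_free_add_def poly_sum poly_monom sum_distrib_left sum_distrib_right
  proof (intro sum.cong refl)
    fix k and ij :: "nat \<times> nat" assume "ij \<in> {(i, j). i + j = k}"
    then obtain i j where ij: "ij = (i, j)" "k = i + j" by auto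
    have sgn: "(- 1) ^ k = (- 1) ^ i * ((- 1) ^ j :: real)"
      by (simp add: ij power_add)
    have sq: "(- 1) ^ i * ((- 1) ^ i * s) = s" for s :: real and i :: nat
      by (simp flip: mult.assoc power_mult_distrib)
    show "(case ij of (i, j) \<Rightarrow> F i j) = fact n * ((- 1) ^ k * (case ij of (i, j) \<Rightarrow>
        fact (n - i) * fact (n - j) / (fact n * fact (n - k)) * signed_coeff n p i * signed_coeff n q j) * x ^ (n - k))"
      unfolding ij(1) split_conv sgn F_def signed_coeff_def by (simp add: ij(2) field_simps sq)
  qed
  finally show ?thesis
    by (simp add: n_def p_def q_def)
qed

lemma permanent_rank_two_sum_of_squares:
  fixes u1 u2 v1 v2 :: "'z::euclidean_space \<Rightarrow> 'a::finite \<Rightarrow> real"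
  assumes "\<And>i. real_polynomial_function (\<lambda>z. u1 z i)" "\<And>i. real_polynomial_function (\<lambda>z. u2 z i)"
    and "\<And>i. real_polynomial_function (\<lambda>z. v1 z i)" "\<And>i. real_polynomial_function (\<lambda>z. v2 z i)"
  defines "M \<equiv> \<lambda>z i j. u1 z i * v1 z j + u2 z i * v2 z j"
  shows "sum_of_squares_polynomial (\<lambda>z. (permanent UNIV (M z) / fact CARD('a))\<^sup>2
    - permanent (UNIV :: ('a \<times> bool) set) (\<lambda>p q. M z (fst p) (fst q)) / fact (2 * CARD('a)))"
proof -
  define c where "c = cycle_weight (UNIV :: 'a set) / fact CARD('a)"
  \<comment> \<open>The form that \<open>cycle_sum_le_sym_sum\<close> shows to be nonnegative on
    \<open>two_row\<close>.\<close>
  define B where "B w w' = c * (w \<bullet> sym_sum UNIV w') - w \<bullet> cycle_sum UNIV w'" for w w' :: "real ^ ('a \<Rightarrow> 'a)"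
  have "bilinear B"
    unfolding bilinear_def B_def
    by (intro conjI allI linearI)
      (auto simp: inner_add_left inner_add_right algebra_simps linear_add[OF linear_sym_sum]
        linear_add[OF linear_cycle_sum] linear_cmul[OF linear_sym_sum] linear_cmul[OF linear_cycle_sum])
  moreover have "B w w' = B w' w" for w w'
    unfolding B_def by (metis inner_commute inner_sym_sum inner_cycle_sum)
  moreover have "B w w \<ge> 0" if "w \<in> two_row" for w
    using cycle_sum_le_sym_sum[OF that, of UNIV] by (simp add: B_def c_def)
  ultimately obtain m :: nat and l where l: "\<And>k. k < m \<Longrightarrow> linear (l k)"
    "\<And>w. w \<in> two_row \<Longrightarrow> B w w = (\<Sum>k<m. (l k w)\<^sup>2)"
    using nonneg_form_sum_squares[OF subspace_two_row, of B] by blast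
  \<comment> \<open>Chosen so that \<open>r * c\<close> is the inverse square of \<open>n!\<close>;
    then \<open>r * B\<close> is the required difference, and \<open>sqrt r\<close> goes into the
    functionals.\<close>
  define r :: real where "r = 4 ^ CARD('a) / fact (2 * CARD('a))"
  have r: "r \<ge> 0" by (simp add: r_def)
  let ?w = "\<lambda>z. perm_products (M z)"
  have "real_polynomial_function (\<lambda>z. M z i j)" for i j
    unfolding M_def using assms(1-4) by (intro real_polynomial_function.intros(3) real_polynomial_function.intros(4))
  then have "real_polynomial_function (\<lambda>z. ?w z $ \<sigma>)" for \<sigma>
    by (cases "\<sigma> permutes UNIV")
      (auto simp: perm_products_def intro!: real_polynomial_function_prod real_polynomial_function.intros(2))
  then have w: "polynomial_function ?w"
    by (auto simp: polynomial_function_iff_Basis_inner Basis_vec_def inner_axis)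
  have "real_polynomial_function (\<lambda>z. sqrt r * l k (?w z))" if "k < m" for k
  proof -
    have "real_polynomial_function (l k \<circ> ?w)"
      using w l(1)[OF that] unfolding polynomial_function_def linear_conv_bounded_linear by blast
    then show ?thesis
      unfolding o_def by (intro real_polynomial_function.intros(4) real_polynomial_function.intros(2))
  qed
  moreover have "(permanent UNIV (M z) / fact CARD('a))\<^sup>2
      - permanent (UNIV :: ('a \<times> bool) set) (\<lambda>p q. M z (fst p) (fst q)) / fact (2 * CARD('a))
      = (\<Sum>k<m. (sqrt r * l k (?w z))\<^sup>2)" for z
  proof -
    have "permanent (UNIV :: ('a \<times> bool) set) (\<lambda>p q. M z (fst p) (fst q))
        = 4 ^ CARD('a) * (?w z \<bullet> cycle_sum UNIV (?w z))"
      unfolding permanent_def permanent_double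
      by (subst sum.swap) (simp add: cycle_sum_def inner_sum_right inner_right_translate_perm_products sum_distrib_left)
    moreover have "r * c = 1 / (fact CARD('a))\<^sup>2"
      using cycle_weight_eq[of "UNIV :: 'a set"] by (simp add: r_def c_def field_simps power2_eq_square)
    ultimately have "(permanent UNIV (M z) / fact CARD('a))\<^sup>2
      - permanent (UNIV :: ('a \<times> bool) set) (\<lambda>p q. M z (fst p) (fst q)) / fact (2 * CARD('a)) = r * B (?w z) (?w z)"
      by (simp add: B_def sym_sum_perm_products right_diff_distrib mult.assoc[symmetric] power_divide) (simp add: r_def)
    also have "B (?w z) (?w z) = (\<Sum>k<m. (l k (?w z))\<^sup>2)"
      by (intro l perm_products_two_row) (simp add: M_def)
    finally show ?thesis
      using r by (simp add: sum_distrib_left power_mult_distrib)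
  qed
  ultimately show ?thesis
    unfolding sum_of_squares_polynomial_def by (intro exI[of _ m] exI[of _ "\<lambda>k z. sqrt r * l k (?w z)"]) auto
qed

text \<open>Squaring doubles each root and \<open>bool\<close> tells the copies apart, so the
  permanent formulas apply to the square in degree \<open>2 * n\<close>.\<close>

lemma poly_of_roots_square:
  "(poly_of_roots \<alpha>)\<^sup>2 = (\<Prod>p\<in>(UNIV :: ('n::finite \<times> bool) set). [:- (\<alpha> $ fst p), 1:])"
proof -
  have "(\<Prod>p\<in>(UNIV :: ('n \<times> bool) set). [:- (\<alpha> $ fst p), 1:]) = (\<Prod>i\<in>UNIV. \<Prod>b\<in>(UNIV :: bool set). [:- (\<alpha> $ i), 1:])"
    by (simp add: prod.cartesian_product split_def del: prod_constant)
  also have "\<dots> = (poly_of_roots \<alpha>)\<^sup>2"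
    by (simp add: poly_of_roots_def prod_power_distrib)
  finally show ?thesis ..
qed

theorem corollary3p4:
  fixes n :: nat
  assumes "n = CARD('n::finite)"
  shows "sum_of_squares_polynomial
           (\<lambda>(x :: real, \<alpha> :: real ^ 'n, \<beta> :: real ^ 'n).
              let p = poly_of_roots \<alpha>; q = poly_of_roots \<beta> in
              (poly (finite_free_add n p q) x)\<^sup>2
                - poly (finite_free_add (2 * n) (p\<^sup>2) (q\<^sup>2)) x)
       \<and> sum_of_squares_polynomial
           (\<lambda>(x :: real, \<alpha> :: real ^ 'n, \<beta> :: real ^ 'n).
              let p = poly_of_roots \<alpha>; q = poly_of_roots \<beta> in
              (poly (finite_free_mult n p q) x)\<^sup>2
                - poly (finite_free_mult (2 * n) (p\<^sup>2) (q\<^sup>2)) x)"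
proof
  let ?x = "\<lambda>z :: real \<times> (real ^ 'n) \<times> (real ^ 'n). fst z"
  let ?a = "\<lambda>z :: real \<times> (real ^ 'n) \<times> (real ^ 'n). \<lambda>i. fst (snd z) $ i"
  let ?b = "\<lambda>z :: real \<times> (real ^ 'n) \<times> (real ^ 'n). \<lambda>i. snd (snd z) $ i"
  have card: "card (UNIV :: ('n \<times> bool) set) = 2 * n"
    by (simp add: assms card_prod mult.commute)
  have x: "real_polynomial_function ?x"
    by (intro real_polynomial_function.intros(1) bounded_linear_fst)
  have a: "real_polynomial_function (\<lambda>z. ?a z i)" for i
    by (intro real_polynomial_function.intros(1) bounded_linear_compose[OF bounded_linear_vec_nth]
        bounded_linear_compose[OF bounded_linear_fst] bounded_linear_snd)
  have b: "real_polynomial_function (\<lambda>z. ?b z i)" for i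
    by (intro real_polynomial_function.intros(1) bounded_linear_compose[OF bounded_linear_vec_nth]
        bounded_linear_compose[OF bounded_linear_snd] bounded_linear_snd)
  have add: "poly (finite_free_add n (poly_of_roots \<alpha>) (poly_of_roots \<beta>)) x
      = permanent UNIV (\<lambda>i j. x - \<alpha> $ i - \<beta> $ j) / fact CARD('n)"
    "poly (finite_free_add (2 * n) ((poly_of_roots \<alpha>)\<^sup>2) ((poly_of_roots \<beta>)\<^sup>2)) x
      = permanent (UNIV :: ('n \<times> bool) set) (\<lambda>p q. x - \<alpha> $ fst p - \<beta> $ fst q) / fact (2 * CARD('n))"
    for x and \<alpha> \<beta> :: "real ^ 'n"
    by (simp add: poly_finite_free_add poly_of_roots_def assms)
      (simp only: poly_of_roots_square poly_finite_free_add[OF finite] card assms[symmetric], simp)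
  have mult: "poly (finite_free_mult n (poly_of_roots \<alpha>) (poly_of_roots \<beta>)) x
      = permanent UNIV (\<lambda>i j. x - \<alpha> $ i * \<beta> $ j) / fact CARD('n)"
    "poly (finite_free_mult (2 * n) ((poly_of_roots \<alpha>)\<^sup>2) ((poly_of_roots \<beta>)\<^sup>2)) x
      = permanent (UNIV :: ('n \<times> bool) set) (\<lambda>p q. x - \<alpha> $ fst p * \<beta> $ fst q) / fact (2 * CARD('n))"
    for x and \<alpha> \<beta> :: "real ^ 'n"
    by (simp add: poly_finite_free_mult poly_of_roots_def assms)
      (simp only: poly_of_roots_square poly_finite_free_mult[OF finite] card assms[symmetric], simp)
  \<comment> \<open>The entries are spelled out as \<open>u1 * v1 + u2 * v2\<close> to match the
    general result; the factors 1 disappear by simplification.\<close>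
  have "sum_of_squares_polynomial (\<lambda>z. (permanent UNIV (\<lambda>i j. (?x z - ?a z i) * 1 + 1 * (- ?b z j)) / fact CARD('n))\<^sup>2
      - permanent (UNIV :: ('n \<times> bool) set) (\<lambda>p q. (?x z - ?a z (fst p)) * 1 + 1 * (- ?b z (fst q))) / fact (2 * CARD('n)))"
    using x a b by (intro permanent_rank_two_sum_of_squares real_polynomial_function_diff
        real_polynomial_function_minus real_polynomial_function.intros(2))
  then show "sum_of_squares_polynomial
           (\<lambda>(x :: real, \<alpha> :: real ^ 'n, \<beta> :: real ^ 'n).
              let p = poly_of_roots \<alpha>; q = poly_of_roots \<beta> in
              (poly (finite_free_add n p q) x)\<^sup>2
                - poly (finite_free_add (2 * n) (p\<^sup>2) (q\<^sup>2)) x)"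
    by (simp add: Let_def add split_def)
  have "sum_of_squares_polynomial (\<lambda>z. (permanent UNIV (\<lambda>i j. ?x z * 1 + (- ?a z i) * ?b z j) / fact CARD('n))\<^sup>2
      - permanent (UNIV :: ('n \<times> bool) set) (\<lambda>p q. ?x z * 1 + (- ?a z (fst p)) * ?b z (fst q)) / fact (2 * CARD('n)))"
    using x a b by (intro permanent_rank_two_sum_of_squares
        real_polynomial_function_minus real_polynomial_function.intros(2))
  then show "sum_of_squares_polynomial
           (\<lambda>(x :: real, \<alpha> :: real ^ 'n, \<beta> :: real ^ 'n).
              let p = poly_of_roots \<alpha>; q = poly_of_roots \<beta> in
              (poly (finite_free_mult n p q) x)\<^sup>2
                - poly (finite_free_mult (2 * n) (p\<^sup>2) (q\<^sup>2)) x)"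
    by (simp add: Let_def mult split_def)
qed

end
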